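(* Let $\boldsymbol\tau$ be an essential triple, $w=w(\boldsymbol\tau)$, and $Y$ the labelled Young diagram corresponding to $w$. For an integer $m\ge 0$, the signed permutation $ws_m$ is vexillary of length $\ell(w)-1$ if and only if $m$ is a removable label of $Y$.
   Context: Write $\bar a$ for $-a$. A signed permutation is a bijection $w$ of $\mathbb Z$ with $w(\bar i)=\overline{w(i)}$ and $w(i)=i$ for $|i|$ large. Simple reflections: for $i>0$, $ws_i$ exchanges the entries of $w$ in positions $i$ and $i+1$; $ws_0$ replaces $w(1)$ by $\overline{w(1)}$. $\ell(w)$ is the length with respect to $s_0,s_1,\dots$. A triple is $\boldsymbol\tau=(\mathbf k,\mathbf p,\mathbf q)$ of $s$-tuples of positive integers with $0<k_1<\cdots<k_s$, $p_1\ge\cdots\ge p_s>0$, $q_1\ge\cdots\ge q_s>0$, and $p_i-p_{i+1}+q_i-q_{i+1}\ge k_{i+1}-k_i$ for $1\le i\le s-1$; it is essential if these are strict. The signed permutation $w(\boldsymbol\tau)$ is built on positions $1,2,\dots,n$ ($n$ large enough): for $i=1,\dots,s$ in turn (with $k_0=0$), take the $k_i-k_{i-1}$ smallest positive integers $c\ge q_i$ not yet used, and place their negatives $\bar c$ in increasing order into the first $k_i-k_{i-1}$ vacant positions that are $\ge p_i$ (left to right), marking these $c$ as used; finally fill the remaining vacant positions, left to right, with the unused positive integers in increasing order. A signed permutation is vexillary if it equals $w(\boldsymbol\tau)$ for some triple. The strict partition $\lambda(\boldsymbol\tau)$ has parts $\lambda_k=p_i+q_i-1+k_i-k$ for $k_{i-1}<k\le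 k_i$ ($k_0=0$), $1\le k\le k_s$. Labelled Young diagrams: for a strict partition $\lambda$, its shifted Young diagram has $\lambda_k$ boxes in row $k$, in columns $k,\dots,k+\lambda_k-1$. A labelled Young diagram of shape $\lambda$ assigns integers $m_1\ge\cdots\ge m_s$ to the SE corners, in rows $k_1<\cdots<k_s$, with $0\le m_i<\lambda_{k_i}$ and $m_i-m_{i+1}\le\lambda_{k_i}-\lambda_{k_{i+1}}$. For an essential triple $\boldsymbol\tau$, the SE corners of the shifted diagram of $\lambda(\boldsymbol\tau)$ are in rows $k_1,\dots,k_s$, and the labelled Young diagram corresponding to $w(\boldsymbol\tau)$ has shape $\lambda(\boldsymbol\tau)$ and label $m_i=p_i-1$ in row $k_i$. A label $m$ of $Y$ is removable if it appears exactly once among the labels of $Y$ and, in case $m=0$, the row in which it appears contains a single box. *)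

theory Defs
  imports Complex_Main "HOL-Library.Infinite_Set" "HOL-Combinatorics.Transposition"
begin

section \<open>Signed permutations\<close>

definition signed_perm :: "(int \<Rightarrow> int) \<Rightarrow> bool" where
  "signed_perm w \<longleftrightarrow> bij w \<and> (\<forall>i. w (- i) = - w i) \<and> (\<exists>N. \<forall>i. \<bar>i\<bar> > N \<longrightarrow> w i = i)"

text \<open>Products are compositions, so multiplication by a simple reflection on the right,
  \<open>w \<circ> simple_refl i\<close>, acts on positions.\<close>

definition simple_refl :: "nat \<Rightarrow> int \<Rightarrow> int" where
  "simple_refl i =
     (if i = 0 then transpose 1 (- 1)
      else transpose (int i) (int i + 1) \<circ> transpose (- int i) (- (int i + 1)))"

definition sp_length :: "(int \<Rightarrow> int) \<Rightarrow> nat" where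
  "sp_length w = (LEAST n. \<exists>xs. length xs = n \<and> w = foldr (\<lambda>i u. simple_refl i \<circ> u) xs id)"


section \<open>Triples\<close>

text \<open>Lists are indexed from 0: the entries \<open>k\<^sub>i, p\<^sub>i, q\<^sub>i\<close> for \<open>1 \<le> i \<le> s\<close> are
  \<open>kk \<tau> ! (i - 1)\<close>, \<open>pp \<tau> ! (i - 1)\<close>, \<open>qq \<tau> ! (i - 1)\<close>.
  The empty triple \<open>s = 0\<close> is allowed; it yields the identity.\<close>

record triple =
  kk :: "nat list"
  pp :: "nat list"
  qq :: "nat list"

abbreviation tsize :: "triple \<Rightarrow> nat" where
  "tsize \<tau> \<equiv> length (kk \<tau>)"

text \<open>With \<open>i\<close> counted from 0, this is the value preceding \<open>kk \<tau> ! i\<close>, with the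
  convention \<open>k\<^sub>0 = 0\<close>.\<close>

definition kprev :: "triple \<Rightarrow> nat \<Rightarrow> nat" where
  "kprev \<tau> i = (if i = 0 then 0 else kk \<tau> ! (i - 1))"

definition is_triple :: "triple \<Rightarrow> bool" where
  "is_triple \<tau> \<longleftrightarrow>
     length (pp \<tau>) = tsize \<tau> \<and> length (qq \<tau>) = tsize \<tau> \<and>
     (\<forall>i < tsize \<tau>. 0 < kk \<tau> ! i \<and> 0 < pp \<tau> ! i \<and> 0 < qq \<tau> ! i) \<and>
     (\<forall>i. Suc i < tsize \<tau> \<longrightarrow>
        kk \<tau> ! i < kk \<tau> ! Suc i \<and> pp \<tau> ! i \<ge> pp \<tau> ! Suc i \<and> qq \<tau> ! i \<ge> qq \<tau> ! Suc i \<and>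
        int (pp \<tau> ! i) - int (pp \<tau> ! Suc i) + int (qq \<tau> ! i) - int (qq \<tau> ! Suc i)
          \<ge> int (kk \<tau> ! Suc i) - int (kk \<tau> ! i))"

definition essential :: "triple \<Rightarrow> bool" where
  "essential \<tau> \<longleftrightarrow> is_triple \<tau> \<and>
     (\<forall>i. Suc i < tsize \<tau> \<longrightarrow>
        int (pp \<tau> ! i) - int (pp \<tau> ! Suc i) + int (qq \<tau> ! i) - int (qq \<tau> ! Suc i)
          > int (kk \<tau> ! Suc i) - int (kk \<tau> ! i))"


section \<open>The signed permutation of a triple\<close>

definition smallest :: "nat \<Rightarrow> nat set \<Rightarrow> nat list" where
  "smallest d S = map (enumerate S) [0..<d]"

text \<open>A partial map \<open>f\<close> with \<open>f x = Some c\<close> records that the entry \<open>- c\<close> has been placed in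
  position \<open>x\<close>; so \<open>dom f\<close> are the occupied positions and \<open>ran f\<close> the used integers.
  The list of values is reversed because it is the negatives that increase from left to right.\<close>

definition place_step :: "nat \<Rightarrow> nat \<Rightarrow> nat \<Rightarrow> (nat \<rightharpoonup> nat) \<Rightarrow> (nat \<rightharpoonup> nat)" where
  "place_step d p q f =
     f ++ map_of (zip (smallest d {x. p \<le> x \<and> x \<notin> dom f})
                      (rev (smallest d {c. q \<le> c \<and> c \<notin> ran f})))"

definition placement :: "triple \<Rightarrow> (nat \<rightharpoonup> nat)" where
  "placement \<tau> =
     fold (\<lambda>i. place_step (kk \<tau> ! i - kprev \<tau> i) (pp \<tau> ! i) (qq \<tau> ! i)) [0..<tsize \<tau>] Map.empty"

text \<open>The remaining vacant positions are filled over all positive integers at once, which agrees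
  with filling positions \<open>1, \<dots>, n\<close> for any sufficiently large \<open>n\<close>, as there are equally many
  occupied positions and used integers. The \<open>j\<close>-th vacant position receives the \<open>j\<close>-th
  unused positive integer.\<close>

definition entry :: "triple \<Rightarrow> nat \<Rightarrow> int" where
  "entry \<tau> x =
     (case placement \<tau> x of
        Some c \<Rightarrow> - int c
      | None \<Rightarrow> int (enumerate {c. 0 < c \<and> c \<notin> ran (placement \<tau>)}
                             (card {y. 0 < y \<and> y < x \<and> y \<notin> dom (placement \<tau>)})))"

definition w_of :: "triple \<Rightarrow> int \<Rightarrow> int" where
  "w_of \<tau> i = (if i > 0 then entry \<tau> (nat i) else if i < 0 then - entry \<tau> (nat (- i)) else 0)"

definition vexillary :: "(int \<Rightarrow> int) \<Rightarrow> bool" where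
  "vexillary w \<longleftrightarrow> signed_perm w \<and> (\<exists>\<tau>. is_triple \<tau> \<and> w = w_of \<tau>)"


section \<open>Labelled Young diagrams\<close>

text \<open>Rows and columns are counted from 1, so the part \<open>\<lambda>\<^sub>k\<close> is \<open>la ! (k - 1)\<close>.\<close>

definition strict_partition :: "nat list \<Rightarrow> bool" where
  "strict_partition la \<longleftrightarrow> sorted_wrt (>) la \<and> (\<forall>a \<in> set la. 0 < a)"

definition shifted_diagram :: "nat list \<Rightarrow> (nat \<times> nat) set" where
  "shifted_diagram la =
     {(r, c). 1 \<le> r \<and> r \<le> length la \<and> r \<le> c \<and> c < r + la ! (r - 1)}"

definition se_corner :: "nat list \<Rightarrow> nat \<times> nat \<Rightarrow> bool" where
  "se_corner la = (\<lambda>(r, c). (r, c) \<in> shifted_diagram la \<and>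
     (Suc r, c) \<notin> shifted_diagram la \<and> (r, Suc c) \<notin> shifted_diagram la)"

definition corner_rows :: "nat list \<Rightarrow> nat list" where
  "corner_rows la = sorted_list_of_set {r. \<exists>c. se_corner la (r, c)}"

text \<open>The \<open>i\<close>-th label sits in the SE corner in row \<open>corner_rows la ! i\<close>.\<close>

record ldiagram =
  shape :: "nat list"
  labels :: "nat list"

definition row_length :: "nat list \<Rightarrow> nat \<Rightarrow> nat" where
  "row_length la r = card {c. (r, c) \<in> shifted_diagram la}"

definition labelled_diagram :: "ldiagram \<Rightarrow> bool" where
  "labelled_diagram Y \<longleftrightarrow>
     strict_partition (shape Y) \<and>
     length (labels Y) = length (corner_rows (shape Y)) \<and>
     (\<forall>i < length (labels Y).
        labels Y ! i < row_length (shape Y) (corner_rows (shape Y) ! i)) \<and>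
     (\<forall>i. Suc i < length (labels Y) \<longrightarrow>
        labels Y ! i \<ge> labels Y ! Suc i \<and>
        int (labels Y ! i) - int (labels Y ! Suc i)
          \<le> int (row_length (shape Y) (corner_rows (shape Y) ! i))
            - int (row_length (shape Y) (corner_rows (shape Y) ! Suc i)))"

definition removable :: "ldiagram \<Rightarrow> nat \<Rightarrow> bool" where
  "removable Y m \<longleftrightarrow>
     count_list (labels Y) m = 1 \<and>
     (m = 0 \<longrightarrow> (\<forall>i < length (labels Y). labels Y ! i = m \<longrightarrow>
        row_length (shape Y) (corner_rows (shape Y) ! i) = 1))"

definition lambda_of :: "triple \<Rightarrow> nat list" where
  "lambda_of \<tau> =
     concat (map (\<lambda>i. map (\<lambda>k. pp \<tau> ! i + qq \<tau> ! i - 1 + kk \<tau> ! i - k)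
                          [Suc (kprev \<tau> i)..<Suc (kk \<tau> ! i)])
                 [0..<tsize \<tau>])"

definition ldiagram_of :: "triple \<Rightarrow> ldiagram" where
  "ldiagram_of \<tau> = \<lparr>shape = lambda_of \<tau>, labels = map (\<lambda>p. p - 1) (pp \<tau>)\<rparr>"


subsection \<open>The diagram of an essential triple is a labelled Young diagram\<close>

lemma row_length_eq:
  assumes "1 \<le> r" "r \<le> length la"
  shows "row_length la r = la ! (r - 1)"
proof -
  have "{c. (r, c) \<in> shifted_diagram la} = {r..<r + la ! (r - 1)}"
    using assms by (auto simp: shifted_diagram_def)
  then show ?thesis by (simp add: row_length_def)
qed

lemma corner_row_iff:
  assumes "strict_partition la"
  shows "(\<exists>c. se_corner la (r, c)) \<longleftrightarrow>
         1 \<le> r \<and> r \<le> length la \<and> (r < length la \<longrightarrow> la ! r + 1 < la ! (r - 1))"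
    (is "?L \<longleftrightarrow> ?R")
proof
  assume ?L
  then obtain c where c: "1 \<le> r" "r \<le> length la" "r \<le> c" "c < r + la ! (r - 1)"
    "(Suc r, c) \<notin> shifted_diagram la" "(r, Suc c) \<notin> shifted_diagram la"
    by (auto simp: se_corner_def shifted_diagram_def)
  have ceq: "Suc c = r + la ! (r - 1)" using c by (auto simp: shifted_diagram_def)
  have "la ! r + 1 < la ! (r - 1)" if r: "r < length la"
  proof -
    have "la ! r < la ! (r - 1)"
      using assms r c(1) by (auto simp: strict_partition_def sorted_wrt_iff_nth_less)
    moreover have "0 < la ! r" using assms r by (auto simp: strict_partition_def)
    ultimately show ?thesis using c(5) r ceq by (auto simp: shifted_diagram_def)
  qed
  then show ?R using c by blast
next
  assume R: ?R
  then have "0 < la ! (r - 1)" using assms by (auto simp: strict_partition_def)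
  then have "se_corner la (r, r + la ! (r - 1) - 1)"
    using R by (auto simp: se_corner_def shifted_diagram_def)
  then show ?L by blast
qed

context
  fixes \<tau> :: triple
  assumes tr: "is_triple \<tau>"
begin

lemma kprev_less: "i < tsize \<tau> \<Longrightarrow> kprev \<tau> i < kk \<tau> ! i"
  using tr unfolding is_triple_def kprev_def by (cases i) auto

lemma lambda_prefix:
  fixes f :: "nat \<Rightarrow> nat \<Rightarrow> nat"
  assumes "j \<le> tsize \<tau>"
  defines "L \<equiv> \<lambda>j. concat (map (\<lambda>i. map (f i) [Suc (kprev \<tau> i)..<Suc (kk \<tau> ! i)]) [0..<j])"
  shows "length (L j) = kprev \<tau> j \<and>
         (\<forall>i < j. \<forall>r. kprev \<tau> i < r \<and> r \<le> kk \<tau> ! i \<longrightarrow> r \<le> kprev \<tau> j \<and> L j ! (r - 1) = f i r)"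
  using assms(1)
proof (induction j)
  case 0
  then show ?case by (simp add: L_def kprev_def)
next
  case (Suc j)
  then have IH: "length (L j) = kprev \<tau> j"
    "\<And>i r. i < j \<Longrightarrow> kprev \<tau> i < r \<Longrightarrow> r \<le> kk \<tau> ! i \<Longrightarrow> r \<le> kprev \<tau> j \<and> L j ! (r - 1) = f i r"
    by auto
  have LS: "L (Suc j) = L j @ map (f j) [Suc (kprev \<tau> j)..<Suc (kk \<tau> ! j)]"
    by (simp add: L_def)
  have lt: "kprev \<tau> j < kk \<tau> ! j" using kprev_less Suc.prems by simp
  have kS: "kprev \<tau> (Suc j) = kk \<tau> ! j" by (simp add: kprev_def)
  have len: "length (L (Suc j)) = kprev \<tau> (Suc j)" using LS IH(1) lt kS by (simp del: upt_Suc)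
  have "r \<le> kprev \<tau> (Suc j) \<and> L (Suc j) ! (r - 1) = f i r"
    if ir: "i < Suc j" "kprev \<tau> i < r" "r \<le> kk \<tau> ! i" for i r
  proof (cases "i = j")
    case True
    then show ?thesis using ir LS IH(1) kS by (auto simp: nth_append simp del: upt_Suc)
  next
    case False
    then have *: "r \<le> kprev \<tau> j" "L j ! (r - 1) = f i r" using IH(2)[of i r] ir by auto
    have "r - 1 < length (L j)" using * ir(2) IH(1) by linarith
    then show ?thesis using * LS lt kS by (simp add: nth_append del: upt_Suc)
  qed
  then show ?case using len by blast
qed

lemma length_lambda_of: "length (lambda_of \<tau>) = kprev \<tau> (tsize \<tau>)"
  using lambda_prefix[of "tsize \<tau>" "\<lambda>i k. pp \<tau> ! i + qq \<tau> ! i - 1 + kk \<tau> ! i - k"]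
  unfolding lambda_of_def by blast

lemma nth_lambda_of:
  assumes "i < tsize \<tau>" "kprev \<tau> i < r" "r \<le> kk \<tau> ! i"
  shows "r \<le> length (lambda_of \<tau>)"
    "lambda_of \<tau> ! (r - 1) = pp \<tau> ! i + qq \<tau> ! i - 1 + kk \<tau> ! i - r"
  using lambda_prefix[of "tsize \<tau>" "\<lambda>i k. pp \<tau> ! i + qq \<tau> ! i - 1 + kk \<tau> ! i - k"] assms
    length_lambda_of unfolding lambda_of_def by auto

lemma block_of_row:
  assumes "j \<le> tsize \<tau>" "1 \<le> r" "r \<le> kprev \<tau> j"
  obtains i where "i < j" "kprev \<tau> i < r" "r \<le> kk \<tau> ! i"
  using assms
proof (induction j arbitrary: thesis)
  case 0
  then show ?case by (simp add: kprev_def)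
next
  case (Suc j)
  show ?case
  proof (cases "r \<le> kprev \<tau> j")
    case True
    then show ?thesis using Suc.IH Suc.prems by (metis Suc_leD less_SucI)
  next
    case False
    moreover have "r \<le> kk \<tau> ! j" using Suc.prems(4) by (simp add: kprev_def)
    ultimately show ?thesis using Suc.prems(1)[of j] by simp
  qed
qed

end

lemma lambda_of_gap:
  assumes tr: "is_triple \<tau>" and r: "1 \<le> r" "r < length (lambda_of \<tau>)"
    and i: "i < tsize \<tau>" "kprev \<tau> i < r" "r \<le> kk \<tau> ! i"
  shows "r < kk \<tau> ! i \<Longrightarrow> lambda_of \<tau> ! (r - 1) = lambda_of \<tau> ! r + 1"
    and "r = kk \<tau> ! i \<Longrightarrow> Suc i < tsize \<tau> \<and>
      int (lambda_of \<tau> ! (r - 1)) - int (lambda_of \<tau> ! r) =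
        int (pp \<tau> ! i) - int (pp \<tau> ! Suc i) + int (qq \<tau> ! i) - int (qq \<tau> ! Suc i)
        - (int (kk \<tau> ! Suc i) - int (kk \<tau> ! i)) + 1"
proof -
  have pos: "0 < pp \<tau> ! i" "0 < qq \<tau> ! i" using tr i(1) by (auto simp: is_triple_def)
  have a: "lambda_of \<tau> ! (r - 1) = pp \<tau> ! i + qq \<tau> ! i - 1 + kk \<tau> ! i - r"
    by (rule nth_lambda_of(2)[OF tr i])
  show "lambda_of \<tau> ! (r - 1) = lambda_of \<tau> ! r + 1" if "r < kk \<tau> ! i"
  proof -
    have "lambda_of \<tau> ! (Suc r - 1) = pp \<tau> ! i + qq \<tau> ! i - 1 + kk \<tau> ! i - Suc r"
      by (rule nth_lambda_of(2)[OF tr i(1)]) (use i that in auto)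
    then show ?thesis using a that pos by simp
  qed
  assume rk: "r = kk \<tau> ! i"
  have Si: "Suc i < tsize \<tau>"
  proof (rule ccontr)
    assume "\<not> ?thesis"
    then have "tsize \<tau> = Suc i" using i by simp
    then show False using r rk length_lambda_of[OF tr] by (simp add: kprev_def)
  qed
  have pos': "0 < pp \<tau> ! Suc i" "0 < qq \<tau> ! Suc i" "kk \<tau> ! i < kk \<tau> ! Suc i"
    using tr Si by (auto simp: is_triple_def)
  have "lambda_of \<tau> ! (Suc r - 1) = pp \<tau> ! Suc i + qq \<tau> ! Suc i - 1 + kk \<tau> ! Suc i - Suc r"
    by (rule nth_lambda_of(2)[OF tr Si]) (use rk pos' in \<open>auto simp: kprev_def\<close>)
  then show "Suc i < tsize \<tau> \<and>
      int (lambda_of \<tau> ! (r - 1)) - int (lambda_of \<tau> ! r) =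
        int (pp \<tau> ! i) - int (pp \<tau> ! Suc i) + int (qq \<tau> ! i) - int (qq \<tau> ! Suc i)
        - (int (kk \<tau> ! Suc i) - int (kk \<tau> ! i)) + 1"
    using Si a rk pos pos' by simp
qed

lemma strict_partition_lambda_of:
  assumes tr: "is_triple \<tau>"
  shows "strict_partition (lambda_of \<tau>)"
proof -
  let ?l = "lambda_of \<tau>"
  have blk: "\<exists>i < tsize \<tau>. kprev \<tau> i < r \<and> r \<le> kk \<tau> ! i" if "1 \<le> r" "r \<le> length ?l" for r
    using block_of_row[OF tr order_refl that(1)] that(2) length_lambda_of[OF tr] by metis
  have "?l ! n > ?l ! Suc n" if n: "Suc n < length ?l" for n
  proof -
    obtain i where i: "i < tsize \<tau>" "kprev \<tau> i < Suc n" "Suc n \<le> kk \<tau> ! i"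
      using blk[of "Suc n"] n by auto
    show ?thesis
    proof (cases "Suc n < kk \<tau> ! i")
      case True
      then show ?thesis using lambda_of_gap(1)[OF tr _ n i] by simp
    next
      case False
      then have eq: "Suc n = kk \<tau> ! i" using i by simp
      show ?thesis using lambda_of_gap(2)[OF tr _ n i eq] tr by (auto simp: is_triple_def)
    qed
  qed
  then have "sorted_wrt (>) ?l"
    by (intro iffD2[OF sorted_wrt_iff_nth_Suc_transp]) (auto simp: transp_def)
  moreover have "0 < ?l ! n" if n: "n < length ?l" for n
  proof -
    obtain i where i: "i < tsize \<tau>" "kprev \<tau> i < Suc n" "Suc n \<le> kk \<tau> ! i"
      using blk[of "Suc n"] n by auto
    then show ?thesis using nth_lambda_of(2)[OF tr i] tr by (auto simp: is_triple_def)
  qed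
  ultimately show ?thesis by (auto simp: strict_partition_def in_set_conv_nth)
qed

lemma corner_rows_lambda_of:
  assumes es: "essential \<tau>"
  shows "corner_rows (lambda_of \<tau>) = kk \<tau>"
proof -
  let ?l = "lambda_of \<tau>"
  have tr: "is_triple \<tau>" using es by (simp add: essential_def)
  have sorted: "sorted_wrt (<) (kk \<tau>)"
    using tr by (intro iffD2[OF sorted_wrt_iff_nth_Suc_transp]) (auto simp: transp_def is_triple_def)
  have "{r. \<exists>c. se_corner ?l (r, c)} = set (kk \<tau>)"
  proof (intro set_eqI iffI)
    fix r assume "r \<in> {r. \<exists>c. se_corner ?l (r, c)}"
    then have r: "1 \<le> r" "r \<le> length ?l" "r < length ?l \<Longrightarrow> ?l ! r + 1 < ?l ! (r - 1)"
      using corner_row_iff[OF strict_partition_lambda_of[OF tr]] by auto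
    obtain i where i: "i < tsize \<tau>" "kprev \<tau> i < r" "r \<le> kk \<tau> ! i"
      using block_of_row[OF tr order_refl r(1)] r(2) length_lambda_of[OF tr] by metis
    have "r = kk \<tau> ! i"
    proof (rule ccontr)
      assume "r \<noteq> kk \<tau> ! i"
      then have lt: "r < kk \<tau> ! i" using i by simp
      have "kk \<tau> ! i \<le> length ?l"
        using nth_lambda_of(1)[OF tr i(1), of "kk \<tau> ! i"] kprev_less[OF tr i(1)] by simp
      then have rl: "r < length ?l" using lt by simp
      show False using lambda_of_gap(1)[OF tr r(1) rl i lt] r(3)[OF rl] by simp
    qed
    then show "r \<in> set (kk \<tau>)" using i by simp
  next
    fix r assume "r \<in> set (kk \<tau>)"
    then obtain i where i: "i < tsize \<tau>" "r = kk \<tau> ! i" by (auto simp: in_set_conv_nth)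
    have i': "kprev \<tau> i < r" "r \<le> kk \<tau> ! i" using kprev_less[OF tr i(1)] i(2) by auto
    have r: "1 \<le> r" "r \<le> length ?l" using i' nth_lambda_of(1)[OF tr i(1) i'] by auto
    have "?l ! r + 1 < ?l ! (r - 1)" if "r < length ?l"
      using lambda_of_gap(2)[OF tr r(1) that i(1) i' i(2)] es by (auto simp: essential_def)
    then show "r \<in> {r. \<exists>c. se_corner ?l (r, c)}"
      using corner_row_iff[OF strict_partition_lambda_of[OF tr]] r by auto
  qed
  then show ?thesis
    using sorted unfolding corner_rows_def
    by (simp add: sorted_list_of_set.idem_if_sorted_distinct strict_sorted_iff)
qed

lemma labelled_diagram_ldiagram_of:
  assumes es: "essential \<tau>"
  shows "labelled_diagram (ldiagram_of \<tau>)"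
proof -
  have tr: "is_triple \<tau>" using es by (simp add: essential_def)
  have rl: "row_length (lambda_of \<tau>) (kk \<tau> ! i) = pp \<tau> ! i + qq \<tau> ! i - 1" if "i < tsize \<tau>" for i
  proof -
    have k: "kprev \<tau> i < kk \<tau> ! i" by (rule kprev_less[OF tr that])
    then show ?thesis
      using nth_lambda_of[OF tr that k order_refl] row_length_eq[of "kk \<tau> ! i" "lambda_of \<tau>"] by simp
  qed
  have len: "length (pp \<tau>) = tsize \<tau>" using tr by (simp add: is_triple_def)
  have pos: "0 < pp \<tau> ! i" "0 < qq \<tau> ! i" if "i < tsize \<tau>" for i
    using tr that by (auto simp: is_triple_def)
  have mono: "pp \<tau> ! i \<ge> pp \<tau> ! Suc i" "qq \<tau> ! i \<ge> qq \<tau> ! Suc i" if "Suc i < tsize \<tau>" for i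
    using tr that by (auto simp: is_triple_def)
  show ?thesis
    unfolding labelled_diagram_def ldiagram_of_def
    using strict_partition_lambda_of[OF tr] len
  proof (simp add: corner_rows_lambda_of[OF es] rl, intro conjI allI impI)
    fix i assume "i < tsize \<tau>"
    then show "pp \<tau> ! i - Suc 0 < pp \<tau> ! i + qq \<tau> ! i - Suc 0" using pos[of i] by simp
  next
    fix i assume i: "Suc i < tsize \<tau>"
    then show "pp \<tau> ! Suc i - Suc 0 \<le> pp \<tau> ! i - Suc 0" using mono[of i] by simp
    show "int (pp \<tau> ! i - Suc 0) - int (pp \<tau> ! Suc i - Suc 0)
      \<le> int (pp \<tau> ! i + qq \<tau> ! i - Suc 0) - int (pp \<tau> ! Suc i + qq \<tau> ! Suc i - Suc 0)"
      using mono[of i] pos[of i] pos[of "Suc i"] i by simp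
  qed
qed

end

theory Submission
  imports Defs
begin

text \<open>
  The length of a signed permutation counts its inversions, so it drops under \<open>w \<mapsto> w s\<^sub>m\<close> exactly
  when \<open>w\<close> has a descent at \<open>m\<close>.

  The main tool is that an entry \<open>- c\<close> placed in position \<open>x\<close> at step \<open>i\<close> satisfies \<open>x < p\<^sub>j\<close> or
  \<open>c < q\<^sub>j\<close> for every earlier step \<open>j\<close>, and even \<open>x + 1 < p\<^sub>j\<close> or \<open>c < q\<^sub>j\<close> for an essential triple:
  otherwise the steps after \<open>j\<close> would have to place more than \<open>k\<^sub>i - k\<^sub>j\<close> entries. Hence
  descents occur only at \<open>m = p\<^sub>i - 1\<close>. If \<open>m + 1 = p\<^sub>i = p\<^sub>i\<^sub>+\<^sub>1\<close>, then some \<open>v\<close> with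
  \<open>q\<^sub>i\<^sub>+\<^sub>1 \<le> v < q\<^sub>i\<close> is still unused after step \<open>i + 1\<close>, and \<open>- v\<close> is the first entry of a 2143
  pattern of \<open>w s\<^sub>m\<close> (on all of the integers) around the positions \<open>m\<close>, \<open>m + 1\<close>, which no
  permutation of a triple can contain. For \<open>m = 0\<close> the obstruction is that \<open>w s\<^sub>0\<close> has a positive
  entry in position 1 that is not the least unused one.
  Conversely, a removable label gives a triple for \<open>w s\<^sub>m\<close> by splitting one step into two.
\<close>

section \<open>Length and descents\<close>

lemma simple_refl_0: "simple_refl 0 i = (if i = 1 then - 1 else if i = - 1 then 1 else i)"
  by (simp add: simple_refl_def transpose_def)

lemma simple_refl_pos:
  "0 < m \<Longrightarrow> simple_refl m i =
    (if i = int m then int m + 1 else if i = int m + 1 then int m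
     else if i = - int m then - int m - 1 else if i = - int m - 1 then - int m else i)"
  by (auto simp: simple_refl_def transpose_def)

lemma simple_refl_involution [simp]: "simple_refl m (simple_refl m i) = i"
  by (cases "m = 0") (auto simp: simple_refl_0 simple_refl_pos)

lemma comp_simple_refl_twice [simp]: "w \<circ> simple_refl m \<circ> simple_refl m = w"
  by (simp add: fun_eq_iff)

lemma simple_refl_minus: "simple_refl m (- i) = - simple_refl m i"
  by (cases "m = 0") (auto simp: simple_refl_0 simple_refl_pos)

lemma simple_refl_fixes: "\<bar>i\<bar> > int m + 1 \<Longrightarrow> simple_refl m i = i"
  by (cases "m = 0") (auto simp: simple_refl_0 simple_refl_pos)

lemma signed_perm_id: "signed_perm id"
  by (auto simp: signed_perm_def)

lemma signed_perm_simple_refl: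
  assumes "signed_perm w"
  shows "signed_perm (w \<circ> simple_refl m)"
proof -
  obtain N where N: "\<And>i. \<bar>i\<bar> > N \<Longrightarrow> w i = i" using assms by (auto simp: signed_perm_def)
  have "bij (simple_refl m)"
    by (rule o_bij[of "simple_refl m"]) (auto simp: fun_eq_iff)
  then have "bij (w \<circ> simple_refl m)" using assms by (auto simp: signed_perm_def intro: bij_comp)
  moreover have "(w \<circ> simple_refl m) i = i" if "\<bar>i\<bar> > max N (int m + 1)" for i
    using that simple_refl_fixes[of m i] N[of i] by simp
  then have "\<exists>N. \<forall>i. \<bar>i\<bar> > N \<longrightarrow> (w \<circ> simple_refl m) i = i" by blast
  ultimately show ?thesis using assms by (simp add: signed_perm_def simple_refl_minus)
qed

text \<open>One representative \<open>(i, j)\<close> is kept from each pair \<open>{(i, j), (- j, - i)}\<close>.\<close>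

definition inversions :: "(int \<Rightarrow> int) \<Rightarrow> (int \<times> int) set" where
  "inversions w = {(i, j). i \<noteq> 0 \<and> - j \<le> i \<and> i < j \<and> w j < w i}"

definition descent :: "(int \<Rightarrow> int) \<Rightarrow> nat \<Rightarrow> bool" where
  "descent w m \<longleftrightarrow> (if m = 0 then w 1 < 0 else w (int m + 1) < w (int m))"

text \<open>Beyond \<open>N\<close> the map is the identity, and by injectivity it preserves the
  window \<open>{- N..N}\<close>. So no inversion has its larger position beyond \<open>N\<close>,
  and \<open>- j \<le> i\<close> then bounds the smaller one.\<close>

lemma finite_inversions:
  assumes "signed_perm w"
  shows "finite (inversions w)"
proof -
  obtain N where N: "\<And>i. \<bar>i\<bar> > N \<Longrightarrow> w i = i" using assms by (auto simp: signed_perm_def)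
  have inj: "w i = w j \<Longrightarrow> i = j" for i j
    using assms by (auto simp: signed_perm_def bij_def inj_def)
  have bd: "\<bar>w i\<bar> \<le> N" if "\<bar>i\<bar> \<le> N" for i
    using N[of "w i"] inj[of "w i" i] that by linarith
  have "inversions w \<subseteq> {- N..N} \<times> {0..N}"
  proof clarify
    fix i j assume "(i, j) \<in> inversions w"
    then have ij: "- j \<le> i" "i < j" "w j < w i" by (auto simp: inversions_def)
    have "j \<le> N"
    proof (rule ccontr)
      assume "\<not> j \<le> N"
      then have "w j = j" using N[of j] ij by linarith
      then show False using N[of i] bd[of i] ij \<open>\<not> j \<le> N\<close> by (cases "\<bar>i\<bar> > N") auto
    qed
    then show "i \<in> {- N..N} \<and> j \<in> {0..N}" using ij by auto
  qed
  then show ?thesis by (rule finite_subset) simp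
qed

text \<open>The one pair whose order the reflection reverses. It is an inversion exactly at a
  descent; for \<open>m = 0\<close> this holds because \<open>w (- 1) = - w 1\<close>.\<close>

definition simple_root :: "nat \<Rightarrow> int \<times> int" where
  "simple_root m = (if m = 0 then (- 1, 1) else (int m, int m + 1))"

text \<open>The pair \<open>(- m, m + 1)\<close> is sent by the reflection to \<open>(- (m + 1), m)\<close>, whose representative is
  again \<open>(- m, m + 1)\<close>.\<close>

definition refl_pair :: "nat \<Rightarrow> int \<times> int \<Rightarrow> int \<times> int" where
  "refl_pair m = (\<lambda>(i, j). if m > 0 \<and> i = - int m \<and> j = int m + 1 then (i, j)
     else (simple_refl m i, simple_refl m j))"

lemma refl_pair_involution: "- j \<le> i \<Longrightarrow> refl_pair m (refl_pair m (i, j)) = (i, j)"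
  by (auto simp: refl_pair_def simple_refl_pos split: if_splits)

lemma refl_pair_inversions:
  assumes odd: "\<And>i. w (- i) = - w i"
  shows "refl_pair m ` (inversions w - {simple_root m}) \<subseteq>
    inversions (w \<circ> simple_refl m) - {simple_root m}"
proof (rule image_subsetI)
  fix ij assume "ij \<in> inversions w - {simple_root m}"
  then obtain i j where eq: "ij = (i, j)" and ij: "(i, j) \<in> inversions w"
    and ne: "(i, j) \<noteq> simple_root m" by (cases ij) auto
  then have *: "i \<noteq> 0" "- j \<le> i" "i < j" "w j < w i" by (auto simp: inversions_def)
  have "refl_pair m (i, j) \<in> inversions (w \<circ> simple_refl m) - {simple_root m}"
  proof (cases "m > 0 \<and> i = - int m \<and> j = int m + 1")
    case True
    then have "w (- int m - 1) = - w j" using odd[of j] by simp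
    then show ?thesis using True * odd[of "int m"]
      by (auto simp: refl_pair_def inversions_def simple_root_def simple_refl_pos)
  next
    case False
    let ?s = "simple_refl m"
    have "?s i \<noteq> 0 \<and> - ?s j \<le> ?s i \<and> ?s i < ?s j \<and> (?s i, ?s j) \<noteq> simple_root m"
      using * ne False
      by (cases "m = 0") (auto simp: simple_refl_0 simple_refl_pos simple_root_def)
    then show ?thesis using * False by (auto simp: refl_pair_def inversions_def)
  qed
  then show "refl_pair m ij \<in> inversions (w \<circ> simple_refl m) - {simple_root m}"
    by (simp only: eq)
qed

text \<open>Away from \<open>simple_root m\<close>, \<open>refl_pair m\<close> matches the
  inversions of the two permutations, and the root is an inversion of exactly one of them.\<close>

lemma card_inversions_simple_refl:
  assumes sp: "signed_perm w"
  shows "descent w m \<Longrightarrow> card (inversions w) = Suc (card (inversions (w \<circ> simple_refl m)))"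
    and "\<not> descent w m \<Longrightarrow> card (inversions (w \<circ> simple_refl m)) = Suc (card (inversions w))"
proof -
  let ?v = "w \<circ> simple_refl m" and ?r = "simple_root m"
  have odd: "\<And>i. w (- i) = - w i" and inj: "\<And>i j. w i = w j \<Longrightarrow> i = j"
    using sp by (auto simp: signed_perm_def bij_def inj_def)
  have spv: "signed_perm ?v" by (rule signed_perm_simple_refl[OF sp])
  have "bij_betw (refl_pair m) (inversions w - {?r}) (inversions ?v - {?r})"
    using refl_pair_inversions[of w m] refl_pair_inversions[of ?v m] odd
    by (intro bij_betw_byWitness[where f' = "refl_pair m"])
      (auto simp: refl_pair_involution simple_refl_minus inversions_def)
  then have eq: "card (inversions w - {?r}) = card (inversions ?v - {?r})"
    by (rule bij_betw_same_card)
  have r1: "?r \<in> inversions w \<longleftrightarrow> descent w m"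
    using odd[of 1] by (auto simp: simple_root_def inversions_def descent_def)
  have "w 1 \<noteq> 0" "w (int m) \<noteq> w (int m + 1)"
    using odd[of 1] inj[of 1 "- 1"] inj[of "int m" "int m + 1"] by auto
  then have r2: "?r \<in> inversions ?v \<longleftrightarrow> \<not> descent w m"
    using odd[of 1]
    by (auto simp: simple_root_def inversions_def descent_def simple_refl_0 simple_refl_pos)
  note fin = finite_inversions[OF sp] finite_inversions[OF spv]
  show "card (inversions w) = Suc (card (inversions ?v))" if "descent w m"
    using that r1 r2 eq fin card_Suc_Diff1[of "inversions w" ?r] by simp
  show "card (inversions ?v) = Suc (card (inversions w))" if "\<not> descent w m"
    using that r1 r2 eq fin card_Suc_Diff1[of "inversions ?v" ?r] by simp
qed

text \<open>Such a \<open>w\<close> is positive and strictly increasing on the positive integers, so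
  \<open>w i - i\<close> is nonnegative and weakly increasing there. It vanishes far out, hence
  everywhere.\<close>

lemma signed_perm_no_descent:
  assumes sp: "signed_perm w" and nd: "\<And>m. \<not> descent w m"
  shows "w = id"
proof -
  have odd: "\<And>i. w (- i) = - w i" and inj: "\<And>i j. w i = w j \<Longrightarrow> i = j"
    using sp by (auto simp: signed_perm_def bij_def inj_def)
  obtain N where N: "\<And>i. \<bar>i\<bar> > N \<Longrightarrow> w i = i" using sp by (auto simp: signed_perm_def)
  have w0: "w 0 = 0" using odd[of 0] by simp
  have w1: "w 1 > 0" using nd[of 0] w0 inj[of 1 0] by (fastforce simp: descent_def)
  have step: "w (int (Suc n)) < w (int (Suc (Suc n)))" for n
    using nd[of "Suc n"] inj[of "int (Suc n)" "int (Suc n) + 1"]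
    by (force simp: descent_def algebra_simps)
  have lower: "int (Suc n) \<le> w (int (Suc n))" for n
  proof (induction n)
    case (Suc n) then show ?case using step[of n] by simp
  qed (use w1 in simp)
  have grow: "w (int (Suc n)) + int t \<le> w (int (Suc (n + t)))" for n t
  proof (induction t)
    case (Suc t) then show ?case using step[of "n + t"] by simp
  qed simp
  have eq: "w (int (Suc n)) = int (Suc n)" for n
    using grow[of n "nat \<bar>N\<bar>"] lower[of n] N[of "int (Suc (n + nat \<bar>N\<bar>))"] by simp
  have pos: "w i = i" if "i > 0" for i
    using eq[of "nat i - 1"] that by simp
  have "w i = i" for i
    using pos[of i] pos[of "- i"] odd[of i] w0 by (cases i "0::int" rule: linorder_cases) auto
  then show ?thesis by auto
qed

section \<open>Words in the simple reflections\<close>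

abbreviation word_prod :: "nat list \<Rightarrow> int \<Rightarrow> int" where
  "word_prod xs \<equiv> foldr (\<lambda>i u. simple_refl i \<circ> u) xs id"

lemma word_prod_snoc: "word_prod (xs @ [m]) = word_prod xs \<circ> simple_refl m"
proof -
  have "foldr (\<lambda>i u. simple_refl i \<circ> u) xs v = word_prod xs \<circ> v" for v
    by (induction xs) (auto simp: comp_assoc)
  then show ?thesis by simp
qed

text \<open>As long as an inversion is left there is a descent, and multiplying by its reflection
  removes exactly one inversion.\<close>

lemma reduced_word_exists:
  assumes "signed_perm w"
  shows "\<exists>xs. length xs = card (inversions w) \<and> w = word_prod xs"
  using assms
proof (induction "card (inversions w)" arbitrary: w)
  case 0
  then have "\<not> descent w m" for m using card_inversions_simple_refl(1)[of w m] by auto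
  then show ?case using signed_perm_no_descent[OF 0(2)] 0(1) by (intro exI[of _ "[]"]) auto
next
  case (Suc n)
  have "inversions id = {}" by (auto simp: inversions_def)
  then obtain m where m: "descent w m"
    using signed_perm_no_descent[OF Suc.prems] Suc.hyps(2) by (metis card.empty nat.distinct(1))
  let ?v = "w \<circ> simple_refl m"
  have c: "card (inversions w) = Suc (card (inversions ?v))"
    using card_inversions_simple_refl(1)[OF Suc.prems m] .
  then obtain xs where xs: "length xs = card (inversions ?v)" "?v = word_prod xs"
    using Suc.hyps(1)[of ?v] Suc.hyps(2) signed_perm_simple_refl[OF Suc.prems] by auto
  have "word_prod (xs @ [m]) = w" by (simp only: word_prod_snoc xs(2)[symmetric]) simp
  then show ?case using xs(1) c by (intro exI[of _ "xs @ [m]"]) auto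
qed

lemma signed_perm_word_prod:
  "signed_perm (word_prod xs) \<and> card (inversions (word_prod xs)) \<le> length xs"
proof (induction xs rule: rev_induct)
  case Nil
  have "inversions id = {}" by (auto simp: inversions_def)
  then show ?case using signed_perm_id by (simp add: id_def)
next
  case (snoc m xs)
  define v where "v = word_prod xs"
  have v: "signed_perm v" "card (inversions v) \<le> length xs" using snoc by (simp_all only: v_def)
  then have "card (inversions (v \<circ> simple_refl m)) \<le> Suc (length xs)"
    using card_inversions_simple_refl[OF v(1), of m] by (cases "descent v m") linarith+
  then show ?case
    using signed_perm_simple_refl[OF v(1), of m]
      by (simp only: word_prod_snoc v_def length_append_singleton)
qed

lemma sp_length_eq_card_inversions:
  assumes "signed_perm w"
  shows "sp_length w = card (inversions w)"
  unfolding sp_length_def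
  by (rule Least_equality) (use reduced_word_exists[OF assms] signed_perm_word_prod in blast)+

lemma sp_length_simple_refl_iff:
  assumes sp: "signed_perm w"
  shows "int (sp_length (w \<circ> simple_refl m)) = int (sp_length w) - 1 \<longleftrightarrow> descent w m"
  using card_inversions_simple_refl[OF sp, of m] sp_length_eq_card_inversions[OF sp]
    sp_length_eq_card_inversions[OF signed_perm_simple_refl[OF sp, of m]]
  by (cases "descent w m") auto


section \<open>Placing the negative entries\<close>

lemma enumerate_image_below:
  fixes S :: "nat set"
  assumes "infinite S"
  shows "{y \<in> S. y < enumerate S n} = enumerate S ` {..<n}"
proof (intro set_eqI iffI)
  fix y assume y: "y \<in> {y \<in> S. y < enumerate S n}"
  then obtain k where "enumerate S k = y" using enumerate_Ex[OF assms, of y] by auto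
  then show "y \<in> enumerate S ` {..<n}" using y assms by (auto simp: image_iff)
qed (use assms enumerate_in_set in auto)

lemma card_below_enumerate:
  fixes S :: "nat set"
  assumes "infinite S"
  shows "card {y \<in> S. y < enumerate S n} = n"
  using card_image[OF inj_on_subset[OF inj_enumerate[OF assms] subset_UNIV]]
  unfolding enumerate_image_below[OF assms] by simp

lemma enumerate_card_below:
  fixes S :: "nat set"
  assumes "infinite S" and "x \<in> S"
  shows "enumerate S (card {y \<in> S. y < x}) = x"
  using enumerate_Ex[OF assms] card_below_enumerate[OF assms(1)] by metis

text \<open>An element is determined by the number of members below it, and a map that is increasing
  on \<open>S\<close> preserves this number.\<close>

lemma enumerate_image_strict_mono:
  fixes S :: "nat set" and h :: "nat \<Rightarrow> nat"
  assumes inf: "infinite S" and mono: "\<And>x y. x \<in> S \<Longrightarrow> y \<in> S \<Longrightarrow> x < y \<Longrightarrow> h x < h y"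
  shows "enumerate (h ` S) n = h (enumerate S n)"
proof -
  let ?x = "enumerate S n"
  have xS: "?x \<in> S" by (rule enumerate_in_set[OF inf])
  have inj: "inj_on h S" by (rule inj_onI) (metis linorder_neqE_nat mono nat_neq_iff)
  have less: "h y < h ?x \<longleftrightarrow> y < ?x" if "y \<in> S" for y
    using mono[OF that xS] mono[OF xS that] by (cases y ?x rule: linorder_cases) auto
  have "{y \<in> h ` S. y < h ?x} = h ` {y \<in> S. y < ?x}" using less by auto
  moreover have "inj_on h {y \<in> S. y < ?x}" using inj by (rule inj_on_subset) auto
  ultimately have "card {y \<in> h ` S. y < h ?x} = n"
    by (simp add: card_image card_below_enumerate[OF inf])
  moreover have "infinite (h ` S)" using inf inj by (simp add: finite_image_iff)
  ultimately show ?thesis using enumerate_card_below[of "h ` S" "h ?x"] xS by simp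
qed

lemma infinite_above: "finite A \<Longrightarrow> infinite {x::nat. p \<le> x \<and> x \<notin> A}"
proof -
  assume "finite A"
  then have "infinite ({p..} - A)" by (simp add: infinite_Ici)
  moreover have "{p..} - A = {x. p \<le> x \<and> x \<notin> A}" by auto
  ultimately show ?thesis by simp
qed

section \<open>Placement steps on finite injective partial maps\<close>

definition finite_matching :: "(nat \<rightharpoonup> nat) \<Rightarrow> bool" where
  "finite_matching f \<longleftrightarrow> finite (dom f) \<and> (\<forall>x y c. f x = Some c \<longrightarrow> f y = Some c \<longrightarrow> x = y)"

abbreviation vacant :: "nat \<Rightarrow> (nat \<rightharpoonup> nat) \<Rightarrow> nat set" where
  "vacant p f \<equiv> {x. p \<le> x \<and> x \<notin> dom f}"

abbreviation unused :: "nat \<Rightarrow> (nat \<rightharpoonup> nat) \<Rightarrow> nat set" where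
  "unused q f \<equiv> {c. q \<le> c \<and> c \<notin> ran f}"

lemma infinite_vacant: "finite_matching f \<Longrightarrow> infinite (vacant p f)"
  by (simp add: finite_matching_def infinite_above)

lemma infinite_unused: "finite_matching f \<Longrightarrow> infinite (unused q f)"
  by (simp add: finite_matching_def infinite_above finite_ran)

text \<open>Trades the lists in \<open>place_step\<close> for two enumerations. The index
  \<open>d - Suc a\<close> comes from \<open>rev\<close>: positions are taken in increasing and
  values in decreasing order.\<close>

lemma place_step_eq_Some_iff:
  assumes f: "finite_matching f"
  shows "place_step d p q f x = Some c \<longleftrightarrow> f x = Some c \<or>
    (\<exists>a<d. x = enumerate (vacant p f) a \<and> c = enumerate (unused q f) (d - Suc a))"
proof -
  define S T where "S = vacant p f" and "T = unused q f"
  have S: "infinite S" unfolding S_def by (rule infinite_vacant[OF f])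
  let ?xs = "smallest d S" and ?ys = "rev (smallest d T)"
  have dist: "distinct ?xs"
    using inj_enumerate[OF S] by (auto simp: smallest_def distinct_map intro: inj_on_subset)
  have set: "set ?xs = enumerate S ` {..<d}" by (auto simp: smallest_def)
  have ps: "place_step d p q f = f ++ map_of (zip ?xs ?ys)"
    by (simp add: place_step_def S_def T_def)
  have len: "length ?xs = d" "length ?ys = d" by (auto simp: smallest_def)
  have nth: "map_of (zip ?xs ?ys) (enumerate S a) = Some (enumerate T (d - Suc a))" if "a < d" for a
    using map_of_zip_nth[OF _ dist, of ?ys a] that len by (simp add: smallest_def rev_nth)
  show ?thesis
    unfolding S_def[symmetric] T_def[symmetric]
  proof (cases "x \<in> set ?xs")
    case True
    then obtain a where a: "a < d" "x = enumerate S a" using set by auto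
    then have "x \<in> S" using enumerate_in_set[OF S] by simp
    then have "f x = None" by (auto simp: S_def)
    moreover have "b = a" if "x = enumerate S b" for b
      using that a(2) injD[OF inj_enumerate[OF S], of b a] by simp
    moreover have "place_step d p q f x = Some (enumerate T (d - Suc a))"
      using nth[OF a(1)] unfolding ps a(2) by (rule map_add_find_right)
    ultimately show "(place_step d p q f x = Some c) = (f x = Some c \<or>
        (\<exists>a<d. x = enumerate S a \<and> c = enumerate T (d - Suc a)))"
      using a by (metis option.distinct(1) option.inject)
  next
    case False
    then have "map_of (zip ?xs ?ys) x = None" using len by (simp add: map_of_zip_is_None)
    then have "place_step d p q f x = f x" unfolding ps by (simp add: map_add_def)
    moreover have "\<not> (\<exists>a<d. x = enumerate S a)" using False set by blast
    ultimately show "(place_step d p q f x = Some c) = (f x = Some c \<or>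
        (\<exists>a<d. x = enumerate S a \<and> c = enumerate T (d - Suc a)))"
      by metis
  qed
qed

lemma dom_place_step:
  assumes "finite_matching f"
  shows "dom (place_step d p q f) = dom f \<union> enumerate (vacant p f) ` {..<d}"
  using place_step_eq_Some_iff[OF assms] by (auto simp: dom_def)

lemma ran_place_step:
  assumes "finite_matching f"
  shows "ran (place_step d p q f) = ran f \<union> enumerate (unused q f) ` {..<d}"
proof (intro set_eqI iffI)
  fix c assume "c \<in> ran (place_step d p q f)"
  then show "c \<in> ran f \<union> enumerate (unused q f) ` {..<d}"
    using place_step_eq_Some_iff[OF assms] by (auto simp: ran_def)
next
  fix c assume "c \<in> ran f \<union> enumerate (unused q f) ` {..<d}"
  then consider "c \<in> ran f" | b where "b < d" "c = enumerate (unused q f) b" by auto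
  then show "c \<in> ran (place_step d p q f)"
  proof cases
    case 1
    then obtain x where "f x = Some c" by (auto simp: ran_def)
    then show ?thesis using place_step_eq_Some_iff[OF assms] by (auto simp: ran_def)
  next
    case 2
    have "place_step d p q f (enumerate (vacant p f) (d - Suc b)) = Some c"
      unfolding place_step_eq_Some_iff[OF assms] using 2
      by (intro disjI2 exI[of _ "d - Suc b"]) auto
    then show ?thesis by (rule ranI)
  qed
qed

lemma place_step_0 [simp]: "place_step 0 p q f = f"
  by (simp add: place_step_def smallest_def)

lemma enumerate_vacant: "finite_matching f \<Longrightarrow> p \<le> enumerate (vacant p f) a \<and> enumerate (vacant p f) a \<notin> dom f"
  using enumerate_in_set[OF infinite_vacant] by blast

lemma enumerate_unused: "finite_matching f \<Longrightarrow> q \<le> enumerate (unused q f) a \<and> enumerate (unused q f) a \<notin> ran f"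
  using enumerate_in_set[OF infinite_unused] by blast

lemma finite_matching_place_step:
  assumes f: "finite_matching f"
  shows "finite_matching (place_step d p q f)"
  unfolding finite_matching_def
proof (intro conjI allI impI)
  show "finite (dom (place_step d p q f))"
    using dom_place_step[OF f] f by (simp add: finite_matching_def)
next
  fix x y c
  assume xy: "place_step d p q f x = Some c" "place_step d p q f y = Some c"
  have old: "x = y" if "f x = Some c" "f y = Some c" using f that
    by (auto simp: finite_matching_def)
  have mixed: "f z \<noteq> Some c" if "c = enumerate (unused q f) b" for b z
    using that enumerate_unused[OF f, of q b] ranI[of f z c] by auto
  have inj: "a = b" if "enumerate (unused q f) a = enumerate (unused q f) b" for a b
    using inj_enumerate[OF infinite_unused[OF f, of q]] that by (simp add: inj_def)
  have cases: "f z = Some c \<or> (\<exists>a<d. z = enumerate (vacant p f) a \<and> c = enumerate (unused q f) (d - Suc a))"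
    if "place_step d p q f z = Some c" for z
    using that place_step_eq_Some_iff[OF f] by simp
  show "x = y"
  proof (cases "f x = Some c")
    case True
    then have "f y = Some c" using cases[OF xy(2)] mixed by blast
    then show ?thesis using old True by simp
  next
    case False
    then obtain a
      where a: "a < d" "x = enumerate (vacant p f) a" "c = enumerate (unused q f) (d - Suc a)"
      using cases[OF xy(1)] by auto
    then have "f y \<noteq> Some c" using mixed by blast
    then obtain b
      where b: "b < d" "y = enumerate (vacant p f) b" "c = enumerate (unused q f) (d - Suc b)"
      using cases[OF xy(2)] by auto
    have "d - Suc a = d - Suc b" using a(3) b(3) inj by simp
    then have "a = b" using a(1) b(1) by linarith
    then show ?thesis using a(2) b(2) by simp
  qed
qed

lemma card_dom_place_step:
  assumes f: "finite_matching f"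
  shows "card (dom (place_step d p q f)) = card (dom f) + d"
proof -
  have "card (enumerate (vacant p f) ` {..<d}) = d"
    using card_image[OF inj_on_subset[OF inj_enumerate[OF infinite_vacant[OF f]] subset_UNIV]]
      by simp
  moreover have "dom f \<inter> enumerate (vacant p f) ` {..<d} = {}"
    using enumerate_vacant[OF f, of p] by blast
  ultimately show ?thesis
    using f unfolding dom_place_step[OF f] finite_matching_def by (simp add: card_Un_disjoint)
qed

section \<open>The stages of a placement\<close>

definition stage :: "triple \<Rightarrow> nat \<Rightarrow> (nat \<rightharpoonup> nat)" where
  "stage \<tau> n =
     fold (\<lambda>i. place_step (kk \<tau> ! i - kprev \<tau> i) (pp \<tau> ! i) (qq \<tau> ! i)) [0..<n] Map.empty"

lemma stage_0 [simp]: "stage \<tau> 0 = Map.empty"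
  by (simp add: stage_def)

lemma stage_Suc:
  "stage \<tau> (Suc n) = place_step (kk \<tau> ! n - kprev \<tau> n) (pp \<tau> ! n) (qq \<tau> ! n) (stage \<tau> n)"
  by (simp add: stage_def)

lemma placement_eq_stage: "placement \<tau> = stage \<tau> (tsize \<tau>)"
  by (simp add: placement_def stage_def)

lemma finite_matching_stage: "finite_matching (stage \<tau> n)"
proof (induction n)
  case (Suc n) then show ?case by (simp add: stage_Suc finite_matching_place_step)
qed (simp add: finite_matching_def)

lemma finite_matching_placement: "finite_matching (placement \<tau>)"
  by (simp add: placement_eq_stage finite_matching_stage)

text \<open>Records the step at which an entry appears, which \<open>stage\<close> and
  \<open>placement\<close> forget; later arguments compare entries by their steps.\<close>

definition placed :: "triple \<Rightarrow> nat \<Rightarrow> nat \<Rightarrow> nat \<Rightarrow> bool" where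
  "placed \<tau> i x c \<longleftrightarrow> x \<notin> dom (stage \<tau> i) \<and> stage \<tau> (Suc i) x = Some c"

lemma placed_iff:
  "placed \<tau> i x c \<longleftrightarrow> (\<exists>a < kk \<tau> ! i - kprev \<tau> i. x = enumerate (vacant (pp \<tau> ! i) (stage \<tau> i)) a \<and>
     c = enumerate (unused (qq \<tau> ! i) (stage \<tau> i)) (kk \<tau> ! i - kprev \<tau> i - Suc a))"
  using place_step_eq_Some_iff[OF finite_matching_stage[of \<tau> i]]
    enumerate_vacant[OF finite_matching_stage[of \<tau> i]]
  unfolding placed_def stage_Suc by blast

lemma stage_eq_Some_iff: "stage \<tau> n x = Some c \<longleftrightarrow> (\<exists>i<n. placed \<tau> i x c)"
proof (induction n)
  case (Suc n)
  have "stage \<tau> (Suc n) x = Some c \<longleftrightarrow> stage \<tau> n x = Some c \<or> placed \<tau> n x c"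
    unfolding placed_iff stage_Suc using place_step_eq_Some_iff[OF finite_matching_stage] by blast
  then show ?case using Suc by (auto simp: less_Suc_eq)
qed simp

lemma placement_eq_Some_iff: "placement \<tau> x = Some c \<longleftrightarrow> (\<exists>i<tsize \<tau>. placed \<tau> i x c)"
  by (simp add: placement_eq_stage stage_eq_Some_iff)

lemma mem_dom_stage_iff: "x \<in> dom (stage \<tau> n) \<longleftrightarrow> (\<exists>i<n. \<exists>c. placed \<tau> i x c)"
  using stage_eq_Some_iff by (auto simp: dom_def)

lemma dom_stage_mono: "n \<le> n' \<Longrightarrow> dom (stage \<tau> n) \<subseteq> dom (stage \<tau> n')"
  unfolding subset_iff mem_dom_stage_iff using less_le_trans by blast

lemma mem_ran_stage_iff: "c \<in> ran (stage \<tau> n) \<longleftrightarrow> (\<exists>i<n. \<exists>x. placed \<tau> i x c)"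
  using stage_eq_Some_iff by (auto simp: ran_def)

lemma placed_ge:
  assumes "placed \<tau> i x c"
  shows "pp \<tau> ! i \<le> x" "qq \<tau> ! i \<le> c" "x \<notin> dom (stage \<tau> i)" "c \<notin> ran (stage \<tau> i)"
  using assms enumerate_vacant[OF finite_matching_stage[of \<tau> i]]
    enumerate_unused[OF finite_matching_stage[of \<tau> i]]
  unfolding placed_iff by blast+

lemma placed_position_unique:
  assumes "placed \<tau> i x c" "placed \<tau> j x c'"
  shows "i = j \<and> c = c'"
proof -
  have "i = j"
    using placed_ge(3)[OF assms(1)] placed_ge(3)[OF assms(2)] assms
    by (metis linorder_neqE_nat mem_dom_stage_iff)
  then show ?thesis using assms by (auto simp: placed_def)
qed

lemma placed_antimono:
  assumes "placed \<tau> i x c" "placed \<tau> i y b" "x < y"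
  shows "b < c"
proof -
  let ?d = "kk \<tau> ! i - kprev \<tau> i"
  note S = infinite_vacant[OF finite_matching_stage[of \<tau> i], of "pp \<tau> ! i"]
  note T = infinite_unused[OF finite_matching_stage[of \<tau> i], of "qq \<tau> ! i"]
  obtain a a' where a: "a < ?d" "a' < ?d" "x = enumerate (vacant (pp \<tau> ! i) (stage \<tau> i)) a"
    "y = enumerate (vacant (pp \<tau> ! i) (stage \<tau> i)) a'"
    "c = enumerate (unused (qq \<tau> ! i) (stage \<tau> i)) (?d - Suc a)"
    "b = enumerate (unused (qq \<tau> ! i) (stage \<tau> i)) (?d - Suc a')"
    using assms(1,2) unfolding placed_iff by blast
  have "a < a'" using assms(3) a(3,4) enumerate_mono_iff[OF S] by blast
  then show ?thesis unfolding a(5,6) using enumerate_mono_iff[OF T] a(1,2) by simp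
qed

text \<open>A step takes the smallest vacant positions from \<open>p\<close> on, so it leaves no gap
  below a position that it fills. The next lemma is the same statement for values.\<close>

lemma placed_fills_positions:
  assumes "placed \<tau> i x c" "pp \<tau> ! i \<le> y" "y < x"
  shows "\<exists>j\<le>i. \<exists>b. placed \<tau> j y b"
proof (rule ccontr)
  let ?S = "vacant (pp \<tau> ! i) (stage \<tau> i)" and ?d = "kk \<tau> ! i - kprev \<tau> i"
  note S = infinite_vacant[OF finite_matching_stage[of \<tau> i], of "pp \<tau> ! i"]
  assume "\<not> ?thesis"
  then have y: "y \<notin> dom (stage \<tau> (Suc i))" by (auto simp: mem_dom_stage_iff less_Suc_eq_le)
  obtain a where a: "a < ?d" "x = enumerate ?S a" using assms(1) unfolding placed_iff by blast
  have "y \<in> ?S" using y assms(2) by (auto simp: mem_dom_stage_iff)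
  then have "y \<in> enumerate ?S ` {..<a}" using assms(3) a enumerate_image_below[OF S, of a] by blast
  then have "y \<in> dom (stage \<tau> (Suc i))"
    using a(1) unfolding stage_Suc dom_place_step[OF finite_matching_stage] by auto
  then show False using y by simp
qed

lemma placed_fills_values:
  assumes "placed \<tau> i x c" "qq \<tau> ! i \<le> b" "b < c"
  shows "\<exists>j\<le>i. \<exists>y. placed \<tau> j y b"
proof (rule ccontr)
  let ?T = "unused (qq \<tau> ! i) (stage \<tau> i)" and ?d = "kk \<tau> ! i - kprev \<tau> i"
  note T = infinite_unused[OF finite_matching_stage[of \<tau> i], of "qq \<tau> ! i"]
  assume "\<not> ?thesis"
  then have b: "b \<notin> ran (stage \<tau> (Suc i))" by (auto simp: mem_ran_stage_iff less_Suc_eq_le)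
  obtain a where a: "a < ?d" "c = enumerate ?T (?d - Suc a)"
    using assms(1) unfolding placed_iff by blast
  have "b \<in> ?T" using b assms(2) by (auto simp: mem_ran_stage_iff)
  then have "b \<in> enumerate ?T ` {..<?d - Suc a}"
    using assms(3) a enumerate_image_below[OF T, of "?d - Suc a"] by blast
  then have "b \<in> ran (stage \<tau> (Suc i))"
    using a(1) unfolding stage_Suc ran_place_step[OF finite_matching_stage] by auto
  then show False using b by simp
qed

lemma placed_exists:
  assumes "kprev \<tau> i < kk \<tau> ! i"
  obtains x c where "placed \<tau> i x c"
  using assms unfolding placed_iff by (metis zero_less_diff)

section \<open>Counting the entries placed between two steps\<close>

context
  fixes \<tau> :: triple
  assumes tr: "is_triple \<tau>"
begin

text \<open>Telescopes the defining inequalities. The last conjunct reads the gap condition as: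
  \<open>k + p + q\<close> never increases along the triple.\<close>

lemma triple_antimono:
  assumes "j \<le> i" "i < tsize \<tau>"
  shows "pp \<tau> ! i \<le> pp \<tau> ! j \<and> qq \<tau> ! i \<le> qq \<tau> ! j \<and> kk \<tau> ! j \<le> kk \<tau> ! i \<and>
    kk \<tau> ! i + pp \<tau> ! i + qq \<tau> ! i \<le> kk \<tau> ! j + pp \<tau> ! j + qq \<tau> ! j"
  using assms
proof (induction i rule: dec_induct)
  case (step n)
  have "kk \<tau> ! n < kk \<tau> ! Suc n \<and> pp \<tau> ! n \<ge> pp \<tau> ! Suc n \<and> qq \<tau> ! n \<ge> qq \<tau> ! Suc n \<and>
        int (pp \<tau> ! n) - int (pp \<tau> ! Suc n) + int (qq \<tau> ! n) - int (qq \<tau> ! Suc n)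
          \<ge> int (kk \<tau> ! Suc n) - int (kk \<tau> ! n)"
    using tr step.prems unfolding is_triple_def by blast
  then show ?case using step.IH step.prems by linarith
qed simp

lemma card_dom_stage: "n \<le> tsize \<tau> \<Longrightarrow> card (dom (stage \<tau> n)) = kprev \<tau> n"
proof (induction n)
  case (Suc n)
  then show ?case
    using kprev_less[OF tr, of n]
    by (simp add: stage_Suc card_dom_place_step finite_matching_stage kprev_def[of \<tau> "Suc n"])
qed (simp add: kprev_def)

text \<open>The entries placed at steps \<open>j + 1, \<dots>, i\<close> fill all the positions from \<open>p\<^sub>i\<close> up to
  \<open>p\<^sub>j - 1\<close> and use all the values from \<open>q\<^sub>i\<close> up to \<open>q\<^sub>j - 1\<close>, and no entry does both.\<close>

lemma placed_count:
  assumes ji: "j < i" "i < tsize \<tau>" and pl: "placed \<tau> i x c"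
    and x: "pp \<tau> ! j \<le> Suc x" and c: "qq \<tau> ! j \<le> c"
    and avoid: "\<And>l. j < l \<Longrightarrow> l < i \<Longrightarrow> x < pp \<tau> ! l \<or> c < qq \<tau> ! l"
  shows "kk \<tau> ! j + pp \<tau> ! j + qq \<tau> ! j \<le> kk \<tau> ! i + pp \<tau> ! i + qq \<tau> ! i"
    and "pp \<tau> ! j \<le> x \<Longrightarrow> kk \<tau> ! j + pp \<tau> ! j + qq \<tau> ! j < kk \<tau> ! i + pp \<tau> ! i + qq \<tau> ! i"
proof -
  \<comment> \<open>The positions filled at steps \<open>j + 1\<close> to \<open>i\<close>; there
    are \<open>kk \<tau> ! i - kk \<tau> ! j\<close> of them.\<close>
  define D where "D = dom (stage \<tau> (Suc i)) - dom (stage \<tau> (Suc j))"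
  have mono: "pp \<tau> ! j \<le> pp \<tau> ! l" "qq \<tau> ! j \<le> qq \<tau> ! l" if "l \<le> j" for l
    using triple_antimono[OF that] ji by auto
  have ge: "pp \<tau> ! i \<le> pp \<tau> ! j" "qq \<tau> ! i \<le> qq \<tau> ! j" "kk \<tau> ! j \<le> kk \<tau> ! i"
    using triple_antimono[of j i] ji by auto
  have D_iff: "y \<in> D \<longleftrightarrow> (\<exists>l. j < l \<and> l \<le> i \<and> (\<exists>b. placed \<tau> l y b))" for y
    unfolding D_def Diff_iff mem_dom_stage_iff less_Suc_eq_le
    by (metis linorder_not_le placed_position_unique)
  have "dom (stage \<tau> (Suc j)) \<subseteq> dom (stage \<tau> (Suc i))"
    using ji by (intro dom_stage_mono) simp
  moreover have finD: "finite (dom (stage \<tau> n))" for n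
    using finite_matching_stage by (auto simp: finite_matching_def)
  ultimately have cardD: "card D = kk \<tau> ! i - kk \<tau> ! j"
    using card_dom_stage[of "Suc i"] card_dom_stage[of "Suc j"] ji
    unfolding D_def by (simp add: card_Diff_subset kprev_def)
  \<comment> \<open>As \<open>pp \<tau> ! j \<le> Suc x\<close>, these positions are at most
    \<open>x\<close>; a possible \<open>y = x\<close> is occupied by the entry \<open>c\<close>
    itself.\<close>
  have P: "{pp \<tau> ! i..<pp \<tau> ! j} \<subseteq> D"
  proof
    fix y assume y: "y \<in> {pp \<tau> ! i..<pp \<tau> ! j}"
    then have "\<exists>l\<le>i. \<exists>b. placed \<tau> l y b"
      using placed_fills_positions[OF pl, of y] pl x by (cases "y = x") auto
    then obtain l b where l: "l \<le> i" "placed \<tau> l y b" by blast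
    have "j < l" using placed_ge(1)[OF l(2)] mono(1)[of l] y by (cases "j < l") auto
    then show "y \<in> D" using l D_iff by blast
  qed
  have "\<exists>y l. j < l \<and> l \<le> i \<and> placed \<tau> l y b" if b: "b \<in> {qq \<tau> ! i..<qq \<tau> ! j}" for b
  proof -
    obtain l y where l: "l \<le> i" "placed \<tau> l y b"
      using placed_fills_values[OF pl, of b] b c by auto
    have "j < l" using placed_ge(2)[OF l(2)] mono(2)[of l] b by (cases "j < l") auto
    then show ?thesis using l by blast
  qed
  \<comment> \<open>\<open>g b\<close> is the position that holds the value
    \<open>b\<close>.\<close>
  then obtain g where g: "\<And>b. b \<in> {qq \<tau> ! i..<qq \<tau> ! j} \<Longrightarrow>
      \<exists>l. j < l \<and> l \<le> i \<and> placed \<tau> l (g b) b"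
    by metis
  define Q where "Q = g ` {qq \<tau> ! i..<qq \<tau> ! j}"
  have "inj_on g {qq \<tau> ! i..<qq \<tau> ! j}"
    by (rule inj_onI) (metis g placed_position_unique)
  then have cardQ: "card Q = qq \<tau> ! j - qq \<tau> ! i" by (simp add: Q_def card_image)
  have Q: "Q \<subseteq> D" using g D_iff unfolding Q_def by blast
  have xQ: "x \<notin> Q"
  proof
    assume "x \<in> Q"
    then obtain b where b: "b < qq \<tau> ! j" "x = g b" "b \<in> {qq \<tau> ! i..<qq \<tau> ! j}"
      by (auto simp: Q_def)
    then show False using g[OF b(3)] placed_position_unique[OF pl] c by (metis linorder_not_le)
  qed
  \<comment> \<open>A common position would hold a value \<open>b < c\<close> to the left of
    \<open>x\<close>. At step \<open>i\<close> this violates the decreasing order within a step; at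
    an earlier step \<open>l\<close> it puts \<open>(x, c)\<close> into the region forbidden by
    \<open>avoid\<close>.\<close>
  have disj: "{pp \<tau> ! i..<pp \<tau> ! j} \<inter> Q = {}"
  proof (rule ccontr)
    assume "\<not> ?thesis"
    then obtain y where y: "y \<in> {pp \<tau> ! i..<pp \<tau> ! j}" "y \<in> Q" by blast
    obtain b where b: "b \<in> {qq \<tau> ! i..<qq \<tau> ! j}" "y = g b" using y(2) unfolding Q_def
      by (rule imageE)
    have gb: "g b < pp \<tau> ! j" using y(1) b(2) by simp
    obtain l where l: "j < l" "l \<le> i" "placed \<tau> l (g b) b" using g[OF b(1)] by blast
    have "g b \<noteq> x" using y(2) b(2) xQ by blast
    then have lt: "g b < x" using gb x by linarith
    show False
    proof (cases "l = i")
      case True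
      then show False using placed_antimono[OF _ pl lt, of b] l(3) b(1) c by auto
    next
      case False
      then show False using avoid[of l] placed_ge(1,2)[OF l(3)] l lt b(1) c by auto
    qed
  qed
  have finD': "finite D" using finD by (simp add: D_def)
  have finPQ: "finite ({pp \<tau> ! i..<pp \<tau> ! j} \<union> Q)" by (simp add: Q_def)
  have cardPQ: "card ({pp \<tau> ! i..<pp \<tau> ! j} \<union> Q) = (pp \<tau> ! j - pp \<tau> ! i) + (qq \<tau> ! j - qq \<tau> ! i)"
    using disj cardQ by (subst card_Un_disjoint) (auto simp: Q_def)
  have "card ({pp \<tau> ! i..<pp \<tau> ! j} \<union> Q) \<le> card D"
    using P Q by (intro card_mono finD') auto
  then show "kk \<tau> ! j + pp \<tau> ! j + qq \<tau> ! j \<le> kk \<tau> ! i + pp \<tau> ! i + qq \<tau> ! i"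
    using cardPQ cardD ge by linarith
  \<comment> \<open>Now \<open>x\<close> is one more element of \<open>D\<close>: it is too large
    for the position interval, and its value is too large for \<open>Q\<close>. This makes the count
    strict.\<close>
  assume "pp \<tau> ! j \<le> x"
  then have "x \<notin> {pp \<tau> ! i..<pp \<tau> ! j} \<union> Q" using xQ by auto
  then have "card (insert x ({pp \<tau> ! i..<pp \<tau> ! j} \<union> Q)) = Suc (card ({pp \<tau> ! i..<pp \<tau> ! j} \<union> Q))"
    using finPQ by simp
  moreover have "x \<in> D" using D_iff pl ji by blast
  then have "card (insert x ({pp \<tau> ! i..<pp \<tau> ! j} \<union> Q)) \<le> card D"
    using P Q by (intro card_mono finD') auto
  ultimately show "kk \<tau> ! j + pp \<tau> ! j + qq \<tau> ! j < kk \<tau> ! i + pp \<tau> ! i + qq \<tau> ! i"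
    using cardPQ cardD ge by linarith
qed

text \<open>By induction the claim holds for the steps strictly between \<open>j\<close> and
  \<open>i\<close>, which is the hypothesis \<open>avoid\<close> of the count. A failure at
  \<open>j\<close> would then make \<open>k + p + q\<close> increase from \<open>j\<close> to
  \<open>i\<close>.\<close>

lemma placed_outside_earlier:
  assumes "j < i" "i < tsize \<tau>" "placed \<tau> i x c"
  shows "x < pp \<tau> ! j \<or> c < qq \<tau> ! j"
  using assms(1)
proof (induction "i - j" arbitrary: j rule: less_induct)
  case less
  show ?case
  proof (rule ccontr)
    assume "\<not> ?thesis"
    then have n: "pp \<tau> ! j \<le> x" "qq \<tau> ! j \<le> c" by auto
    have "kk \<tau> ! j + pp \<tau> ! j + qq \<tau> ! j < kk \<tau> ! i + pp \<tau> ! i + qq \<tau> ! i"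
      by (rule placed_count(2)[OF less.prems assms(2,3)]) (use n less.hyps less.prems in auto)
    then show False using triple_antimono[of j i] less.prems assms(2) by simp
  qed
qed

end

lemma essential_decreasing:
  assumes es: "essential \<tau>" and "j < i" "i < tsize \<tau>"
  shows "kk \<tau> ! i + pp \<tau> ! i + qq \<tau> ! i < kk \<tau> ! j + pp \<tau> ! j + qq \<tau> ! j"
proof -
  have "int (pp \<tau> ! j) - int (pp \<tau> ! Suc j) + int (qq \<tau> ! j) - int (qq \<tau> ! Suc j)
          > int (kk \<tau> ! Suc j) - int (kk \<tau> ! j)"
    using assms by (auto simp: essential_def)
  moreover have "kk \<tau> ! i + pp \<tau> ! i + qq \<tau> ! i \<le> kk \<tau> ! Suc j + pp \<tau> ! Suc j + qq \<tau> ! Suc j"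
    using triple_antimono[of \<tau> "Suc j" i] assms by (simp add: essential_def)
  ultimately show ?thesis by linarith
qed

text \<open>For an essential triple \<open>k + p + q\<close> strictly decreases, so the weak form of
  the count, which allows \<open>pp \<tau> ! j = Suc x\<close>, is already contradictory.\<close>

lemma placed_outside_earlier_essential:
  assumes es: "essential \<tau>" and ji: "j < i" "i < tsize \<tau>" and pl: "placed \<tau> i x c"
  shows "Suc x < pp \<tau> ! j \<or> c < qq \<tau> ! j"
proof (rule ccontr)
  have tr: "is_triple \<tau>" using es by (simp add: essential_def)
  assume "\<not> ?thesis"
  then have n: "pp \<tau> ! j \<le> Suc x" "qq \<tau> ! j \<le> c" by auto
  have "kk \<tau> ! j + pp \<tau> ! j + qq \<tau> ! j \<le> kk \<tau> ! i + pp \<tau> ! i + qq \<tau> ! i"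
    by (rule placed_count(1)[OF tr ji pl n]) (use placed_outside_earlier[OF tr _ ji(2) pl] in auto)
  then show False using essential_decreasing[OF es ji] by simp
qed


section \<open>The entries of the signed permutation\<close>

text \<open>\<open>entry\<close> with the placement as a parameter, so that altered partial maps can
  be filled without first knowing a triple for them.\<close>

definition fill :: "(nat \<rightharpoonup> nat) \<Rightarrow> nat \<Rightarrow> int" where
  "fill f x = (case f x of Some c \<Rightarrow> - int c
     | None \<Rightarrow> int (enumerate {c. 0 < c \<and> c \<notin> ran f} (card {y. 0 < y \<and> y < x \<and> y \<notin> dom f})))"

lemma entry_eq_fill: "entry \<tau> = fill (placement \<tau>)"
  by (simp add: fun_eq_iff entry_def fill_def)

lemma w_of_pos: "0 < x \<Longrightarrow> w_of \<tau> (int x) = fill (placement \<tau>) x"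
  by (simp add: w_of_def entry_eq_fill)

lemma w_of_minus: "w_of \<tau> (- i) = - w_of \<tau> i"
  by (simp add: w_of_def)

lemma infinite_unused_pos: "finite_matching f \<Longrightarrow> infinite {c. 0 < c \<and> c \<notin> ran f}"
  using infinite_unused[of f 1] by (simp add: Suc_le_eq)

lemma fill_Some: "f x = Some c \<Longrightarrow> fill f x = - int c"
  by (simp add: fill_def)

lemma fill_None:
  assumes f: "finite_matching f" and "f x = None"
  shows "0 < fill f x" "nat (fill f x) \<notin> ran f"
  using enumerate_in_set[OF infinite_unused_pos[OF f]] assms(2) by (auto simp: fill_def)

lemma fill_eq_uminus_iff:
  assumes "finite_matching f" "0 < c"
  shows "fill f x = - int c \<longleftrightarrow> f x = Some c"
  using assms fill_None(1)[of f x] by (cases "f x") (auto simp: fill_Some)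

lemma fill_strict_mono:
  assumes f: "finite_matching f" and x: "f x = None" "0 < x" "x < y" and y: "f y = None"
  shows "fill f x < fill f y"
proof -
  have "card {z. 0 < z \<and> z < x \<and> z \<notin> dom f} < card {z. 0 < z \<and> z < y \<and> z \<notin> dom f}"
    using x by (intro psubset_card_mono) auto
  then show ?thesis using x(1) y enumerate_mono_iff[OF infinite_unused_pos[OF f]]
    by (simp add: fill_def)
qed

lemma fill_1_least:
  assumes "f 1 = None" "0 < v" "v \<notin> ran f"
  shows "fill f 1 \<le> int v"
proof -
  have *: "{y. 0 < y \<and> y < (1::nat) \<and> y \<notin> dom f} = {}" by auto
  have "fill f 1 = int (enumerate {c. 0 < c \<and> c \<notin> ran f} 0)"
    using assms(1) unfolding fill_def * by simp
  then show ?thesis using assms(2,3) by (simp add: enumerate_0 Least_le)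
qed

lemma fill_inj:
  assumes f: "finite_matching f" and xy: "0 < x" "0 < y" "\<bar>fill f x\<bar> = \<bar>fill f y\<bar>"
  shows "x = y"
proof (cases "f x"; cases "f y")
  fix c c' assume "f x = Some c" "f y = Some c'"
  then show ?thesis using f xy by (auto simp: fill_Some finite_matching_def)
next
  fix c assume c: "f x = Some c" and n: "f y = None"
  then have "fill f y = int c" using fill_None(1)[OF f n] xy(3) by (simp add: fill_Some)
  then show ?thesis using fill_None(2)[OF f n] ranI[of f x c] c by simp
next
  fix c assume n: "f x = None" and c: "f y = Some c"
  then have "fill f x = int c" using fill_None(1)[OF f n] xy(3) by (simp add: fill_Some)
  then show ?thesis using fill_None(2)[OF f n] ranI[of f y c] c by simp
next
  assume "f x = None" "f y = None"
  then show ?thesis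
    using fill_strict_mono[OF f, of x y] fill_strict_mono[OF f, of y x]
      fill_None(1)[OF f, of x] fill_None(1)[OF f, of y] xy
    by (cases x y rule: linorder_cases) auto
qed

lemma fill_eventually_id:
  assumes f: "finite_matching f" and z: "0 \<notin> dom f" "0 \<notin> ran f"
    and x: "0 < x" "\<And>y. y \<in> dom f \<union> ran f \<Longrightarrow> y < x"
  shows "fill f x = int x"
proof -
  have fin: "finite (dom f)" "finite (ran f)" using f by (auto simp: finite_matching_def finite_ran)
  have "ran f = (\<lambda>x. the (f x)) ` dom f" by (force simp: ran_def dom_def image_def)
  moreover have "inj_on (\<lambda>x. the (f x)) (dom f)"
    using f by (auto simp: inj_on_def finite_matching_def)
  ultimately have card: "card (ran f) = card (dom f)" by (simp add: card_image)
  have pos: "0 < y" if "y \<in> dom f \<union> ran f" for y using that z by (cases "y = 0") auto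
  have "{y. 0 < y \<and> y < x \<and> y \<notin> dom f} = {1..<x} - dom f" by auto
  moreover have "{y \<in> {c. 0 < c \<and> c \<notin> ran f}. y < x} = {1..<x} - ran f" by auto
  moreover have "dom f \<subseteq> {1..<x}" "ran f \<subseteq> {1..<x}" using pos x(2) by (force simp: Suc_le_eq)+
  ultimately have "card {y. 0 < y \<and> y < x \<and> y \<notin> dom f} = card {y \<in> {c. 0 < c \<and> c \<notin> ran f}. y < x}"
    using card fin by (simp add: card_Diff_subset)
  moreover have "x \<notin> dom f" "x \<notin> ran f" using x(2)[of x] by auto
  ultimately show ?thesis
    using enumerate_card_below[OF infinite_unused_pos[OF f], of x] x(1)
    by (simp add: fill_def domIff)
qed

section \<open>The map of a triple is a signed permutation\<close>

lemma placement_pos: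
  assumes tr: "is_triple \<tau>" and "placement \<tau> x = Some c"
  shows "0 < x" "0 < c"
proof -
  obtain i where i: "i < tsize \<tau>" "placed \<tau> i x c" using assms(2) placement_eq_Some_iff by blast
  then have "0 < pp \<tau> ! i" "0 < qq \<tau> ! i" using tr by (auto simp: is_triple_def)
  then show "0 < x" "0 < c" using placed_ge(1,2)[OF i(2)] by auto
qed

lemma signed_perm_w_of:
  assumes tr: "is_triple \<tau>"
  shows "signed_perm (w_of \<tau>)"
proof -
  let ?f = "placement \<tau>"
  note f = finite_matching_placement[of \<tau>]
  have nz: "fill ?f x \<noteq> 0" for x
    using fill_None(1)[OF f, of x] placement_pos(2)[OF tr, of x]
    by (cases "?f x") (auto simp: fill_Some)
  have inj: "w_of \<tau> i = w_of \<tau> j \<Longrightarrow> i = j" for i j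
  proof -
    assume eq: "w_of \<tau> i = w_of \<tau> j"
    have z: "w_of \<tau> k = 0 \<longleftrightarrow> k = 0" for k using nz by (auto simp: w_of_def entry_eq_fill)
    have "nat \<bar>i\<bar> = nat \<bar>j\<bar>" if "i \<noteq> 0" "j \<noteq> 0"
      using that eq by (intro fill_inj[OF f]) (auto simp: w_of_def entry_eq_fill split: if_splits)
    then have abs: "\<bar>i\<bar> = \<bar>j\<bar>" using z[of i] z[of j] eq by (cases "i = 0"; cases "j = 0") auto
    show "i = j"
    proof (rule ccontr)
      assume "i \<noteq> j"
      then have "j = - i" using abs by linarith
      then have "w_of \<tau> i = 0" using eq w_of_minus[of \<tau> i] by simp
      then show False using z[of i] \<open>i \<noteq> j\<close> \<open>j = - i\<close> by simp
    qed
  qed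
  have fin: "finite (dom ?f \<union> ran ?f)" using f by (auto simp: finite_matching_def finite_ran)
  define N where "N = int (Max (insert 0 (dom ?f \<union> ran ?f)))"
  have N: "w_of \<tau> i = i" if "i > N" for i
  proof -
    have "fill ?f (nat i) = int (nat i)"
    proof (rule fill_eventually_id[OF f])
      show "0 \<notin> dom ?f" "0 \<notin> ran ?f"
        using placement_pos[OF tr] by (force simp: dom_def, force simp: ran_def)
      show "0 < nat i" using that by (simp add: N_def)
      fix y assume "y \<in> dom ?f \<union> ran ?f"
      then have "int y \<le> N" using fin by (auto simp: N_def intro!: Max_ge)
      then show "y < nat i" using that by simp
    qed
    moreover have "N \<ge> 0" by (simp add: N_def)
    ultimately show ?thesis using w_of_pos[of "nat i" \<tau>] that by simp
  qed
  have N': "w_of \<tau> i = i" if "\<bar>i\<bar> > N" for i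
    using N[of i] N[of "- i"] w_of_minus[of \<tau> i] that by (cases "i > 0") auto
  have "\<exists>i. w_of \<tau> i = j" for j
  proof (cases "\<bar>j\<bar> > N")
    case True then show ?thesis using N' by blast
  next
    case False
    \<comment> \<open>A value outside the window would be a fixed point and so collide with itself
      as a position. Surjectivity then follows from injectivity on a finite set.\<close>
    have "w_of \<tau> i \<in> {- N..N}" if "i \<in> {- N..N}" for i
    proof (rule ccontr)
      assume n: "w_of \<tau> i \<notin> {- N..N}"
      then have "w_of \<tau> (w_of \<tau> i) = w_of \<tau> i" by (intro N') auto
      then show False using inj[of "w_of \<tau> i" i] n that by simp
    qed
    then have "w_of \<tau> ` {- N..N} = {- N..N}"
      using inj by (intro endo_inj_surj) (auto simp: inj_on_def)
    then have "j \<in> w_of \<tau> ` {- N..N}" using False by auto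
    then show ?thesis by blast
  qed
  then have "bij (w_of \<tau>)" using inj by (metis bij_def injI surjI)
  then show ?thesis using w_of_minus N' unfolding signed_perm_def by blast
qed

text \<open>Position \<open>m + 1\<close> must hold a placed entry. If its step allowed position
  \<open>m\<close> as well, \<open>m\<close> would be filled by then, and with a larger value, so
  there would be no descent.\<close>

lemma descent_w_of_position:
  assumes tr: "is_triple \<tau>" and ds: "descent (w_of \<tau>) m"
  shows "\<exists>i<tsize \<tau>. pp \<tau> ! i = Suc m"
proof -
  let ?f = "placement \<tau>"
  note f = finite_matching_placement[of \<tau>]
  have w: "w_of \<tau> (int m + 1) = fill ?f (Suc m)" using w_of_pos[of "Suc m" \<tau>]
    by (simp add: add.commute)
  have less: "fill ?f (Suc m) < (if m = 0 then 0 else fill ?f m)"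
    using ds w w_of_pos[of m \<tau>] by (auto simp: descent_def split: if_splits)
  have "?f (Suc m) \<noteq> None"
    using less fill_None(1)[OF f, of "Suc m"] fill_None(1)[OF f, of m] fill_strict_mono[OF f, of m "Suc m"]
    by (cases "?f m") (auto simp: fill_Some split: if_splits)
  then obtain c i where c: "?f (Suc m) = Some c" and i: "i < tsize \<tau>" "placed \<tau> i (Suc m) c"
    using placement_eq_Some_iff by blast
  have "pp \<tau> ! i = Suc m"
  proof (rule ccontr)
    assume "pp \<tau> ! i \<noteq> Suc m"
    then have le: "pp \<tau> ! i \<le> m" using placed_ge(1)[OF i(2)] by simp
    then have "m > 0" using tr i(1) by (force simp: is_triple_def)
    obtain j b where j: "j \<le> i" "placed \<tau> j m b" using placed_fills_positions[OF i(2) le] by auto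
    then have "?f m = Some b" using i(1) placement_eq_Some_iff by (meson le_less_trans)
    then have bc: "b < c" using less \<open>m > 0\<close> c by (simp add: fill_Some)
    show False
    proof (cases "j = i")
      case True
      then show False using placed_antimono[of \<tau> i m b "Suc m" c] j(2) i(2) bc by simp
    next
      case False
      then show False using placed_outside_earlier[OF tr _ i, of j] j(1) placed_ge(1,2)[OF j(2)] bc
        by simp
    qed
  qed
  then show ?thesis using i(1) by blast
qed

text \<open>Step \<open>i\<close> fills some position from \<open>pp \<tau> ! i\<close> on, so this
  position itself is filled by then. Earlier steps start strictly further right.\<close>

lemma placed_at_first_position:
  assumes tr: "is_triple \<tau>" and i: "i < tsize \<tau>" and first: "\<And>j. j < i \<Longrightarrow> pp \<tau> ! j \<noteq> pp \<tau> ! i"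
  obtains c where "placed \<tau> i (pp \<tau> ! i) c" "qq \<tau> ! i \<le> c"
proof -
  obtain x c where xc: "placed \<tau> i x c" using placed_exists[OF kprev_less[OF tr i]] .
  have "\<exists>b. placed \<tau> i (pp \<tau> ! i) b"
  proof (cases "x = pp \<tau> ! i")
    case False
    then obtain j b where j: "j \<le> i" "placed \<tau> j (pp \<tau> ! i) b"
      using placed_fills_positions[OF xc, of "pp \<tau> ! i"] placed_ge(1)[OF xc] by auto
    have "pp \<tau> ! j \<le> pp \<tau> ! i" using placed_ge(1)[OF j(2)] .
    then have "j = i" using first[of j] triple_antimono[OF tr j(1) i] j(1) by (cases "j = i") auto
    then show ?thesis using j(2) by blast
  qed (use xc in blast)
  then show ?thesis using that placed_ge(2) by blast
qed

text \<open>The forbidden pattern 2143 consists of the entries \<open>- v\<close>, \<open>- c\<close>, \<open>X\<close>, \<open>- u\<close> of \<open>w\<close>, the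
  middle two in positions \<open>m\<close>, \<open>m + 1\<close> and the last in position \<open>b\<close>. The entry \<open>- v\<close> may be in a
  negative position, in which case the last hypothesis holds vacuously.\<close>

lemma no_2143:
  assumes tr: "is_triple \<tau>" and m: "0 < m"
    and c: "placement \<tau> m = Some c" and X: "w_of \<tau> (int (Suc m)) > - int u"
    and b: "Suc m < b" "placement \<tau> b = Some u"
    and uvc: "u < v" "v < c" and v: "\<And>a. placement \<tau> a = Some v \<Longrightarrow> a < m"
  shows False
proof -
  obtain s where s: "s < tsize \<tau>" "placed \<tau> s m c" using c placement_eq_Some_iff by blast
  obtain t where t: "t < tsize \<tau>" "placed \<tau> t b u" using b placement_eq_Some_iff by blast
  note star = placed_outside_earlier[OF tr]
  show False
  proof (cases "s \<le> t")
    case True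
    \<comment> \<open>Step \<open>t\<close> reaches past position \<open>Suc m\<close>, which is
      therefore filled by then. By \<open>X\<close> its value is below \<open>u\<close>, although it
      lies to the left of \<open>b\<close>.\<close>
    then have "pp \<tau> ! t \<le> Suc m" using triple_antimono[OF tr True t(1)] placed_ge(1)[OF s(2)]
      by simp
    then obtain r x where r: "r \<le> t" "placed \<tau> r (Suc m) x"
      using placed_fills_positions[OF t(2) _ b(1)] by blast
    then have "placement \<tau> (Suc m) = Some x" using t(1) placement_eq_Some_iff
      by (meson le_less_trans)
    then have "x < u" using X w_of_pos[of "Suc m" \<tau>] by (simp add: fill_Some)
    then show False
      using placed_antimono[OF _ t(2) b(1), of x] star[OF _ t, of r] r placed_ge(1,2)[OF r(2)] b(1)
      by (cases "r = t") auto
  next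
    case False
    \<comment> \<open>Dually, step \<open>s\<close> uses a value beyond \<open>v\<close>, so
      \<open>v\<close> is used by then. Its position is to the left of \<open>m\<close>, although
      \<open>v < c\<close>.\<close>
    then have "qq \<tau> ! s \<le> v"
      using triple_antimono[OF tr, of t s] s(1) placed_ge(2)[OF t(2)] uvc(1) by simp
    then obtain r a where r: "r \<le> s" "placed \<tau> r a v"
      using placed_fills_values[OF s(2) _ uvc(2)] by blast
    then have "placement \<tau> a = Some v" using s(1) placement_eq_Some_iff by (meson le_less_trans)
    then have "a < m" by (rule v)
    then show False
      using placed_antimono[of \<tau> s a v m c] star[OF _ s, of r] r s(2) placed_ge(1,2)[OF r(2)] uvc(2)
      by (cases "r = s") auto
  qed
qed

lemma repeated_position_gap:
  assumes es: "essential \<tau>" and i: "Suc i < tsize \<tau>" and eq: "pp \<tau> ! Suc i = pp \<tau> ! i"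
  obtains v x u where "qq \<tau> ! Suc i \<le> v" "v < qq \<tau> ! i" "v \<notin> ran (stage \<tau> (Suc (Suc i)))"
    "placed \<tau> (Suc i) x u" "u < v"
proof -
  have tr: "is_triple \<tau>" using es by (simp add: essential_def)
  let ?d = "kk \<tau> ! Suc i - kprev \<tau> (Suc i)" and ?I = "{qq \<tau> ! Suc i..<qq \<tau> ! i}"
  let ?E = "enumerate (unused (qq \<tau> ! Suc i) (stage \<tau> (Suc i))) ` {..<?d}"
  have "\<not> ?I \<subseteq> ran (stage \<tau> (Suc (Suc i)))"
  proof
    assume sub: "?I \<subseteq> ran (stage \<tau> (Suc (Suc i)))"
    have "?I \<inter> ran (stage \<tau> (Suc i)) = {}"
    proof (rule ccontr)
      assume "\<not> ?thesis"
      then obtain b j x where "b < qq \<tau> ! i" "j \<le> i" "placed \<tau> j x b"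
        by (auto simp: mem_ran_stage_iff less_Suc_eq_le)
      then show False using placed_ge(2)[of \<tau> j x b] triple_antimono[OF tr, of j i] i by simp
    qed
    then have "?I \<subseteq> ?E"
      using sub unfolding stage_Suc[of \<tau> "Suc i"] ran_place_step[OF finite_matching_stage] by blast
    then have "card ?I \<le> card ?E" by (intro card_mono) auto
    also have "\<dots> \<le> ?d" using card_image_le[of "{..<?d}"] by simp
    finally have "qq \<tau> ! i \<le> qq \<tau> ! Suc i + (kk \<tau> ! Suc i - kk \<tau> ! i)" by (simp add: kprev_def)
    moreover have "kk \<tau> ! Suc i + qq \<tau> ! Suc i < kk \<tau> ! i + qq \<tau> ! i" "kk \<tau> ! i \<le> kk \<tau> ! Suc i"
      using essential_decreasing[OF es, of i "Suc i"] i eq triple_antimono[OF tr, of i "Suc i"]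
        by simp_all
    ultimately show False by linarith
  qed
  then obtain v where v: "qq \<tau> ! Suc i \<le> v" "v < qq \<tau> ! i" "v \<notin> ran (stage \<tau> (Suc (Suc i)))"
    by (meson atLeastLessThan_iff subsetI)
  obtain x u where xu: "placed \<tau> (Suc i) x u" using placed_exists[OF kprev_less[OF tr i]] .
  have "u < v"
  proof (rule ccontr)
    assume "\<not> u < v"
    then have "\<exists>j\<le>Suc i. \<exists>y. placed \<tau> j y v"
      using placed_fills_values[OF xu v(1)] xu by (cases "u = v") auto
    then show False using v(3) by (auto simp: mem_ran_stage_iff less_Suc_eq_le)
  qed
  then show ?thesis using that v xu by blast
qed

section \<open>Necessity: vexillarity after multiplication at a descent\<close>

lemma placement_of_reflected:
  assumes eq: "w_of \<tau> \<circ> simple_refl m = w_of \<tau>'"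
    and x: "0 < x" "0 < y" "simple_refl m (int x) = int y" and c: "0 < c"
  shows "placement \<tau>' x = Some c \<longleftrightarrow> placement \<tau> y = Some c"
proof -
  have "fill (placement \<tau>') x = fill (placement \<tau>) y"
    using fun_cong[OF eq, of "int x"] w_of_pos[OF x(1), of \<tau>'] w_of_pos[OF x(2), of \<tau>] x(3) by simp
  then show ?thesis using fill_eq_uminus_iff[OF finite_matching_placement c] by metis
qed

lemma vexillary_descent_unique:
  assumes es: "essential \<tau>" and tr': "is_triple \<tau>'" and eq: "w_of \<tau> \<circ> simple_refl m = w_of \<tau>'"
    and ds: "descent (w_of \<tau>) m"
  shows "\<exists>i<tsize \<tau>. pp \<tau> ! i = Suc m \<and> (\<forall>j<tsize \<tau>. pp \<tau> ! j = Suc m \<longrightarrow> j = i) \<and>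
    (m = 0 \<longrightarrow> qq \<tau> ! i = 1)"
proof -
  have tr: "is_triple \<tau>" using es by (simp add: essential_def)
  note f = finite_matching_placement[of \<tau>]
  define i where "i = (LEAST i. i < tsize \<tau> \<and> pp \<tau> ! i = Suc m)"
  have "i < tsize \<tau> \<and> pp \<tau> ! i = Suc m"
    unfolding i_def using descent_w_of_position[OF tr ds] by (rule LeastI_ex)
  then have i: "i < tsize \<tau>" "pp \<tau> ! i = Suc m" by auto
  have first: "pp \<tau> ! j \<noteq> pp \<tau> ! i" if "j < i" for j
    using that i not_less_Least[of j "\<lambda>i. i < tsize \<tau> \<and> pp \<tau> ! i = Suc m"]
      by (auto simp: i_def[symmetric])
  obtain c where c: "placed \<tau> i (Suc m) c" "qq \<tau> ! i \<le> c"
    using placed_at_first_position[OF tr i(1) first] i(2) by metis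
  have fc: "placement \<tau> (Suc m) = Some c" using c(1) i(1) placement_eq_Some_iff by blast
  have c0: "0 < c" using placement_pos[OF tr fc] by simp
  \<comment> \<open>A repeated \<open>pp\<close> occurs already at \<open>Suc i\<close>, where the
    gap value \<open>v\<close> and an entry \<open>u\<close> provide the outer entries of the
    pattern. If \<open>v\<close> is never placed, the condition on \<open>a\<close> is vacuous.
    Positions of \<open>v\<close> and the value in \<open>m\<close> belong to steps after
    \<open>Suc i\<close>, so the essential bound controls both.\<close>
  have rep: "\<exists>v x u. u < v \<and> v < c \<and> 0 < u \<and> Suc m < x \<and> placement \<tau> x = Some u \<and>
      (\<forall>a. placement \<tau> a = Some v \<longrightarrow> a < m) \<and> (\<forall>b. placement \<tau> m = Some b \<longrightarrow> b < u)"
    if j: "j < tsize \<tau>" "pp \<tau> ! j = Suc m" "j \<noteq> i" for j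
  proof -
    have "i < j" using first[of j] j i by (cases i j rule: linorder_cases) auto
    then have Si: "Suc i < tsize \<tau>" "pp \<tau> ! Suc i = pp \<tau> ! i"
      using triple_antimono[OF tr, of i "Suc i"] triple_antimono[OF tr, of "Suc i" j] j i by auto
    obtain v x u where v: "qq \<tau> ! Suc i \<le> v" "v < qq \<tau> ! i" "v \<notin> ran (stage \<tau> (Suc (Suc i)))"
      and u: "placed \<tau> (Suc i) x u" "u < v" using repeated_position_gap[OF es Si] .
    have fu: "placement \<tau> x = Some u" using u(1) Si(1) placement_eq_Some_iff by blast
    have "x \<noteq> Suc m" using placed_position_unique[OF u(1)] c(1) by (metis n_not_Suc_n)
    then have x: "Suc m < x" using placed_ge(1)[OF u(1)] Si(2) i(2) by simp
    have later: "Suc i < l" if "placed \<tau> l a v" for l a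
    proof (rule ccontr)
      assume "\<not> Suc i < l"
      then have "l < Suc (Suc i)" by simp
      then have "v \<in> ran (stage \<tau> (Suc (Suc i)))" using that unfolding mem_ran_stage_iff by blast
      then show False using v(3) by simp
    qed
    have a: "a < m" if av: "placement \<tau> a = Some v" for a
    proof -
      obtain l where l: "l < tsize \<tau>" "placed \<tau> l a v" using av placement_eq_Some_iff by blast
      then show ?thesis
        using placed_outside_earlier_essential[OF es later[OF l(2)] l] v(1) Si(2) i(2) by simp
    qed
    have b: "b < u" if mb: "placement \<tau> m = Some b" for b
    proof -
      obtain l where l: "l < tsize \<tau>" "placed \<tau> l m b" using mb placement_eq_Some_iff by blast
      have "Suc i < l"
        using placed_ge(1)[OF l(2)] triple_antimono[OF tr, of l "Suc i"] Si i(2)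
          by (cases "Suc i < l") auto
      then show ?thesis
        using placed_outside_earlier_essential[OF es _ l, of "Suc i"] Si(2) i(2) placed_ge(2)[OF u(1)] by simp
    qed
    show ?thesis
      using a b u(2) v(2) c(2) x fu placement_pos(2)[OF tr fu] less_le_trans by blast
  qed
  have m0: False if m: "m = 0" and v: "0 < v" "v < c" "v \<notin> ran (placement \<tau>)" for v
  proof -
    have "w_of \<tau> (- 1) = int c"
      using w_of_pos[of 1 \<tau>] w_of_minus[of \<tau> 1] fc m by (simp add: fill_Some)
    then have w1: "fill (placement \<tau>') 1 = int c"
      using fun_cong[OF eq, of 1] w_of_pos[of 1 \<tau>'] m by (simp add: simple_refl_0)
    then have none: "placement \<tau>' 1 = None"
      using c0 by (cases "placement \<tau>' 1") (auto simp: fill_Some)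
    have "v \<notin> ran (placement \<tau>')"
    proof
      assume "v \<in> ran (placement \<tau>')"
      then obtain a where a: "placement \<tau>' a = Some v" by (auto simp: ran_def)
      then have "a > 1" using none placement_pos(1)[OF tr' a] by (cases "a = 1") auto
      then have "placement \<tau> a = Some v"
        using placement_of_reflected[OF eq, of a a v] a v(1) m by (simp add: simple_refl_0)
      then show False using v(3) by (auto simp: ran_def)
    qed
    then show False using fill_1_least[of "placement \<tau>'" v] none v(1) w1 v(2) by simp
  qed
  have uniq: "j = i" if j: "j < tsize \<tau>" "pp \<tau> ! j = Suc m" for j
  proof (rule ccontr)
    assume "j \<noteq> i"
    then obtain v x u where uv: "u < v" "v < c" "0 < u" "Suc m < x" "placement \<tau> x = Some u"
      and a: "\<And>a. placement \<tau> a = Some v \<Longrightarrow> a < m" and b: "\<And>b. placement \<tau> m = Some b \<Longrightarrow> b < u"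
      using rep[OF j] by blast
    show False
    proof (cases "m = 0")
      case True
      then have "v \<notin> ran (placement \<tau>)" using a by (auto simp: ran_def)
      then show False using m0[OF True, of v] uv by simp
    next
      case False
      then have m: "0 < m" by simp
      have s: "simple_refl m (int m) = int (Suc m)" "simple_refl m (int (Suc m)) = int m"
        "\<And>a. a \<noteq> m \<Longrightarrow> a \<noteq> Suc m \<Longrightarrow> simple_refl m (int a) = int a"
        using m by (auto simp: simple_refl_pos)
      show False
      proof (rule no_2143[OF tr' m])
        show "placement \<tau>' m = Some c" using placement_of_reflected[OF eq m _ s(1) c0] fc by simp
        have "w_of \<tau>' (int (Suc m)) = fill (placement \<tau>) m"
          using fun_cong[OF eq, of "int (Suc m)"] s(2) w_of_pos[OF m, of \<tau>] by simp
        then show "- int u < w_of \<tau>' (int (Suc m))"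
          using b fill_None(1)[OF f, of m] by (cases "placement \<tau> m") (auto simp: fill_Some)
        show "Suc m < x" "u < v" "v < c" by fact+
        show "placement \<tau>' x = Some u"
          using placement_of_reflected[OF eq, of x x u] s(3)[of x] uv by simp
        fix a assume a': "placement \<tau>' a = Some v"
        have pos: "0 < a" "0 < v" using placement_pos[OF tr' a'] by auto
        consider "a = m" | "a = Suc m" | "a \<noteq> m" "a \<noteq> Suc m" by blast
        then show "a < m"
        proof cases
          case 1
          then show ?thesis using placement_of_reflected[OF eq m _ s(1) pos(2)] a' a by fastforce
        next
          case 2
          then show ?thesis using placement_of_reflected[OF eq _ m s(2) pos(2)] a' a by fastforce
        next
          case 3
          then show ?thesis using placement_of_reflected[OF eq pos(1) pos(1) s(3) pos(2)] a' a
            by blast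
        qed
      qed
    qed
  qed
  \<comment> \<open>Since \<open>pp\<close> cannot drop below 1, uniqueness makes \<open>i\<close>
    the last step. If its \<open>qq\<close> exceeds 1, then so do all others, and the value 1
    contradicts \<open>m0\<close>.\<close>
  have "qq \<tau> ! i = 1" if m: "m = 0"
  proof (rule ccontr)
    assume q: "qq \<tau> ! i \<noteq> 1"
    have q2: "2 \<le> qq \<tau> ! l" if l: "l < tsize \<tau>" for l
    proof -
      have "l \<le> i"
      proof (rule ccontr)
        assume "\<not> l \<le> i"
        then have "pp \<tau> ! l \<le> 1" "pp \<tau> ! l > 0"
          using triple_antimono[OF tr, of i l] l i m tr by (auto simp: is_triple_def)
        then have "l = i" using uniq[OF l] m by simp
        then show False using \<open>\<not> l \<le> i\<close> by simp
      qed
      moreover have "qq \<tau> ! i > 0" using tr i(1) by (simp add: is_triple_def)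
      ultimately show ?thesis using triple_antimono[OF tr _ i(1), of l] q by simp
    qed
    have "1 \<notin> ran (placement \<tau>)"
    proof
      assume "1 \<in> ran (placement \<tau>)"
      then obtain l x where "l < tsize \<tau>" "placed \<tau> l x 1"
        using placement_eq_Some_iff by (auto simp: ran_def)
      then show False using q2[of l] placed_ge(2)[of \<tau> l x 1] by simp
    qed
    moreover have "1 < c" using q2[OF i(1)] c(2) by simp
    ultimately show False using m0[OF m, of 1] by simp
  qed
  then show ?thesis using i uniq by blast
qed


section \<open>Triples as lists of steps\<close>

text \<open>A step \<open>(d, p, q)\<close> stands for \<open>place_step d p q\<close>, so \<open>d\<close> is the difference
  \<open>k\<^sub>i - k\<^sub>i\<^sub>-\<^sub>1\<close>.\<close>

type_synonym step = "nat \<times> nat \<times> nat"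

definition run :: "step list \<Rightarrow> (nat \<rightharpoonup> nat) \<Rightarrow> (nat \<rightharpoonup> nat)" where
  "run = fold (\<lambda>(d, p, q). place_step d p q)"

definition steps :: "triple \<Rightarrow> step list" where
  "steps \<tau> = map (\<lambda>i. (kk \<tau> ! i - kprev \<tau> i, pp \<tau> ! i, qq \<tau> ! i)) [0..<tsize \<tau>]"

text \<open>The last inequality is the gap condition of \<open>is_triple\<close>, with
  \<open>d'\<close> as the difference of consecutive \<open>kk\<close>.\<close>

definition admissible :: "step list \<Rightarrow> bool" where
  "admissible L \<longleftrightarrow> (\<forall>(d, p, q) \<in> set L. 0 < d \<and> 0 < p \<and> 0 < q) \<and>
     successively (\<lambda>(d, p, q) (d', p', q'). p' \<le> p \<and> q' \<le> q \<and> d' + p' + q' \<le> p + q) L"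

definition triple_of :: "step list \<Rightarrow> triple" where
  "triple_of L = \<lparr>kk = map (\<lambda>i. \<Sum>l<Suc i. fst (L ! l)) [0..<length L],
     pp = map (\<lambda>(d, p, q). p) L, qq = map (\<lambda>(d, p, q). q) L\<rparr>"

lemma run_append: "run (A @ B) f = run B (run A f)"
  by (simp add: run_def)

lemma run_Cons: "run ((d, p, q) # B) f = run B (place_step d p q f)"
  by (simp add: run_def)

lemma run_Nil [simp]: "run [] f = f"
  by (simp add: run_def)

lemma run_take_steps: "i \<le> tsize \<tau> \<Longrightarrow> run (take i (steps \<tau>)) Map.empty = stage \<tau> i"
  by (simp add: run_def steps_def stage_def take_map fold_map comp_def)

lemma placement_eq_run: "placement \<tau> = run (steps \<tau>) Map.empty"
  using run_take_steps[of "tsize \<tau>" \<tau>] by (simp add: placement_eq_stage steps_def)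

lemma successively_iff_nth:
  "successively P xs \<longleftrightarrow> (\<forall>i. Suc i < length xs \<longrightarrow> P (xs ! i) (xs ! Suc i))"
proof (induction P xs rule: successively.induct)
  case (3 P x y xs)
  show ?case
    unfolding successively.simps 3
  proof (intro iffI allI impI conjI)
    fix i
    assume "P x y \<and> (\<forall>i. Suc i < length (y # xs) \<longrightarrow> P ((y # xs) ! i) ((y # xs) ! Suc i))"
      "Suc i < length (x # y # xs)"
    then show "P ((x # y # xs) ! i) ((x # y # xs) ! Suc i)" by (cases i) auto
  next
    assume *: "\<forall>i. Suc i < length (x # y # xs) \<longrightarrow> P ((x # y # xs) ! i) ((x # y # xs) ! Suc i)"
    show "P x y" using *[rule_format, of 0] by simp
    fix i assume "Suc i < length (y # xs)"
    then show "P ((y # xs) ! i) ((y # xs) ! Suc i)" using *[rule_format, of "Suc i"] by simp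
  qed
qed auto

lemma admissible_steps:
  assumes tr: "is_triple \<tau>"
  shows "admissible (steps \<tau>)"
  unfolding admissible_def successively_iff_nth
proof (intro conjI allI impI)
  show "\<forall>(d, p, q) \<in> set (steps \<tau>). 0 < d \<and> 0 < p \<and> 0 < q"
    using tr kprev_less[OF tr] by (auto simp: steps_def is_triple_def)
  fix i assume "Suc i < length (steps \<tau>)"
  then have i: "Suc i < tsize \<tau>" by (simp add: steps_def)
  then show "(\<lambda>(d, p, q) (d', p', q'). p' \<le> p \<and> q' \<le> q \<and> d' + p' + q' \<le> p + q)
      (steps \<tau> ! i) (steps \<tau> ! Suc i)"
    using triple_antimono[OF tr, of i "Suc i"] by (simp add: steps_def kprev_def, linarith)
qed

lemma kprev_triple_of: "i \<le> length L \<Longrightarrow> kprev (triple_of L) i = (\<Sum>l<i. fst (L ! l))"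
  by (cases i) (auto simp: kprev_def triple_of_def)

lemma kk_triple_of: "i < length L \<Longrightarrow> kk (triple_of L) ! i = kprev (triple_of L) i + fst (L ! i)"
  by (simp add: kprev_triple_of) (simp add: triple_of_def)

lemma tsize_triple_of: "tsize (triple_of L) = length L"
  by (simp add: triple_of_def)

lemma pp_qq_triple_of:
  "i < length L \<Longrightarrow> pp (triple_of L) ! i = fst (snd (L ! i)) \<and> qq (triple_of L) ! i = snd (snd (L ! i))"
  by (simp add: triple_of_def case_prod_beta)

lemma steps_triple_of: "steps (triple_of L) = L"
  by (rule nth_equalityI) (simp_all add: steps_def tsize_triple_of kk_triple_of pp_qq_triple_of)

lemma is_triple_triple_of:
  assumes "admissible L"
  shows "is_triple (triple_of L)"
proof -
  have pos: "0 < fst (L ! i) \<and> 0 < fst (snd (L ! i)) \<and> 0 < snd (snd (L ! i))"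
    if "i < length L" for i
    using assms nth_mem[OF that] unfolding admissible_def by (force simp: case_prod_beta)
  have suc: "fst (snd (L ! Suc i)) \<le> fst (snd (L ! i)) \<and> snd (snd (L ! Suc i)) \<le> snd (snd (L ! i)) \<and>
      fst (L ! Suc i) + fst (snd (L ! Suc i)) + snd (snd (L ! Suc i)) \<le> fst (snd (L ! i)) + snd (snd (L ! i))"
    if "Suc i < length L" for i
    using assms that unfolding admissible_def successively_iff_nth by (simp add: case_prod_beta)
  have k: "kk (triple_of L) ! Suc i = kk (triple_of L) ! i + fst (L ! Suc i)"
    if "Suc i < length L" for i
    using kk_triple_of[OF that] by (simp add: kprev_def)
  show ?thesis
    unfolding is_triple_def tsize_triple_of
  proof (intro conjI allI impI)
    show "length (pp (triple_of L)) = length L" "length (qq (triple_of L)) = length L"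
      by (simp_all add: triple_of_def)
    fix i assume i: "i < length L"
    show "0 < kk (triple_of L) ! i" using pos[OF i] kk_triple_of[OF i] by simp
    show "0 < pp (triple_of L) ! i" "0 < qq (triple_of L) ! i" using pos[OF i] pp_qq_triple_of[OF i]
      by auto
  next
    fix i assume i: "Suc i < length L"
    note * = pos[OF i] suc[OF i] k[OF i] pp_qq_triple_of[OF i] pp_qq_triple_of[of i L] i
    show "kk (triple_of L) ! i < kk (triple_of L) ! Suc i"
      "pp (triple_of L) ! Suc i \<le> pp (triple_of L) ! i" "qq (triple_of L) ! Suc i \<le> qq (triple_of L) ! i"
      using * by auto
    show "int (kk (triple_of L) ! Suc i) - int (kk (triple_of L) ! i)
      \<le> int (pp (triple_of L) ! i) - int (pp (triple_of L) ! Suc i) + int (qq (triple_of L) ! i) -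
        int (qq (triple_of L) ! Suc i)"
      using * by simp
  qed
qed

lemma placement_triple_of: "placement (triple_of L) = run L Map.empty"
  by (simp add: placement_eq_run steps_triple_of)

section \<open>Splitting one step into two\<close>

lemma map_eqI: "(\<And>x c. g x = Some c \<longleftrightarrow> h x = Some c) \<Longrightarrow> g = h"
  by (rule ext) (metis not_None_eq)

text \<open>The vacant position \<open>p\<close> is the first to be filled and receives the largest
  of the new values, the one with index \<open>n\<close>.\<close>

lemma place_step_first:
  assumes f: "finite_matching f" and p: "p \<notin> dom f"
  shows "place_step (Suc n) p q f = (place_step n (Suc p) q f)(p \<mapsto> enumerate (unused q f) n)"
proof (rule map_eqI)
  fix x c
  define S S1 T where "S = vacant p f" and "S1 = vacant (Suc p) f" and "T = unused q f"
  have "(LEAST x. x \<in> S) = p" using p by (intro Least_equality) (auto simp: S_def)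
  then have e0: "enumerate S 0 = p" by (simp add: enumerate_0)
  moreover have "S - {p} = S1" using p by (auto simp: S_def S1_def)
  ultimately have eS: "enumerate S (Suc a) = enumerate S1 a" for a by (simp add: enumerate_Suc')
  have ge: "enumerate S1 a \<noteq> p" for a using enumerate_vacant[OF f, of "Suc p" a]
    by (auto simp: S1_def)
  have "place_step (Suc n) p q f x = Some c \<longleftrightarrow>
      f x = Some c \<or> x = p \<and> c = enumerate T n \<or> (\<exists>a<n. x = enumerate S1 a \<and> c = enumerate T (n - Suc a))"
    unfolding place_step_eq_Some_iff[OF f] S_def[symmetric] T_def[symmetric] Ex_less_Suc2 e0 eS
      by simp
  moreover have "place_step n (Suc p) q f x = Some c \<longleftrightarrow>
      f x = Some c \<or> (\<exists>a<n. x = enumerate S1 a \<and> c = enumerate T (n - Suc a))"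
    unfolding place_step_eq_Some_iff[OF f] S1_def[symmetric] T_def[symmetric] by simp
  moreover have "f p = None" using p by auto
  ultimately show "place_step (Suc n) p q f x = Some c \<longleftrightarrow>
      ((place_step n (Suc p) q f)(p \<mapsto> enumerate (unused q f) n)) x = Some c"
    unfolding T_def[symmetric] using ge by (cases "x = p") auto
qed

lemma enumerate_unused_place_step:
  assumes f: "finite_matching f"
  shows "enumerate (unused q (place_step n p q f)) 0 = enumerate (unused q f) n"
proof -
  define T where "T = unused q f"
  have T: "infinite T" unfolding T_def by (rule infinite_unused[OF f])
  have eq: "unused q (place_step n p q f) = T - enumerate T ` {..<n}"
    unfolding ran_place_step[OF f] T_def by auto
  have "(LEAST c. c \<in> T - enumerate T ` {..<n}) = enumerate T n"
  proof (rule Least_equality)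
    show "enumerate T n \<in> T - enumerate T ` {..<n}"
      using enumerate_in_set[OF T] injD[OF inj_enumerate[OF T]] by blast
    fix c assume "c \<in> T - enumerate T ` {..<n}"
    then show "enumerate T n \<le> c" using enumerate_image_below[OF T, of n]
      by (metis DiffD1 DiffD2 linorder_not_le mem_Collect_eq)
  qed
  then show ?thesis unfolding eq T_def[symmetric] by (simp add: enumerate_0)
qed

lemma place_step_not_dom:
  assumes "finite_matching f" "x < p" "x \<notin> dom f"
  shows "place_step d p q f x = None"
proof -
  have "x \<noteq> enumerate (vacant p f) a" for a
    using enumerate_vacant[OF assms(1), of p a] assms(2) by auto
  then have "x \<notin> dom (place_step d p q f)" using assms(3) unfolding dom_place_step[OF assms(1)]
    by blast
  then show ?thesis by auto
qed

lemma place_step_split: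
  assumes f: "finite_matching f" and m: "m \<notin> dom f" "Suc m \<notin> dom f"
  shows "place_step 1 m q (place_step n (Suc (Suc m)) q f) =
    place_step (Suc n) (Suc m) q f \<circ> transpose m (Suc m)"
proof -
  let ?g = "place_step n (Suc (Suc m)) q f"
  have g: "finite_matching ?g" by (rule finite_matching_place_step[OF f])
  have none: "?g m = None" "?g (Suc m) = None" using place_step_not_dom[OF f] m by auto
  then have "m \<notin> dom ?g" by auto
  then have "place_step 1 m q ?g = ?g(m \<mapsto> enumerate (unused q f) n)"
    using place_step_first[OF g, of m 0 q] enumerate_unused_place_step[OF f] by simp
  moreover have "place_step (Suc n) (Suc m) q f = ?g(Suc m \<mapsto> enumerate (unused q f) n)"
    using place_step_first[OF f m(2)] by simp
  ultimately show ?thesis using none by (auto simp: fun_eq_iff transpose_def)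
qed

section \<open>Carrying the exchange of two positions through later steps\<close>

lemma transpose_Suc_less_iff:
  assumes "y \<noteq> z" "\<not> (y \<in> {m, Suc m} \<and> z \<in> {m, Suc m})"
  shows "transpose m (Suc m) y < transpose m (Suc m) z \<longleftrightarrow> y < z"
  using assms by (auto simp: transpose_def)

lemma finite_matching_transpose:
  assumes "finite_matching f"
  shows "finite_matching (f \<circ> transpose a b)"
proof -
  have "dom (f \<circ> transpose a b) = transpose a b ` dom f"
    by (auto simp: dom_def image_iff) (metis transpose_involutory)
  then show ?thesis using assms by (auto simp: finite_matching_def) (metis transpose_involutory)
qed

lemma ran_transpose: "ran (f \<circ> transpose a b) = ran f"
  by (auto simp: ran_def) (metis transpose_involutory)

text \<open>At most one of \<open>m\<close>, \<open>m + 1\<close> is vacant, so the exchange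
  preserves the order of vacant positions; \<open>p \<le> m\<close> keeps it from crossing the bound
  \<open>p\<close>.\<close>

lemma place_step_transpose:
  assumes f: "finite_matching f" and p: "p \<le> m" and occ: "m \<in> dom f \<or> Suc m \<in> dom f"
  shows "place_step d p q (f \<circ> transpose m (Suc m)) = place_step d p q f \<circ> transpose m (Suc m)"
proof (rule map_eqI)
  fix x c
  let ?s = "transpose m (Suc m)"
  define S T where "S = vacant p f" and "T = unused q f"
  have S: "infinite S" unfolding S_def by (rule infinite_vacant[OF f])
  have ge: "p \<le> ?s y \<longleftrightarrow> p \<le> y" for y using p by (auto simp: transpose_def)
  have "vacant p (f \<circ> ?s) = ?s ` S"
  proof (intro set_eqI iffI)
    fix y assume "y \<in> vacant p (f \<circ> ?s)"
    then have "?s y \<in> S" using ge by (auto simp: S_def)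
    then show "y \<in> ?s ` S" by (metis imageI transpose_involutory)
  qed (use ge in \<open>auto simp: S_def\<close>)
  moreover have "enumerate (?s ` S) a = ?s (enumerate S a)" for a
    using S
  proof (rule enumerate_image_strict_mono)
    fix y z assume "y \<in> S" "z \<in> S" "y < z"
    then show "?s y < ?s z" using transpose_Suc_less_iff[of y z m] occ by (auto simp: S_def)
  qed
  ultimately have e: "enumerate (vacant p (f \<circ> ?s)) a = ?s (enumerate S a)" for a by simp
  have sw: "x = ?s y \<longleftrightarrow> ?s x = y" for y by (metis transpose_involutory)
  have "place_step d p q (f \<circ> ?s) x = Some c \<longleftrightarrow>
      f (?s x) = Some c \<or> (\<exists>a<d. ?s x = enumerate S a \<and> c = enumerate T (d - Suc a))"
    unfolding place_step_eq_Some_iff[OF finite_matching_transpose[OF f]] e sw ran_transpose T_def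
    by simp
  then show "place_step d p q (f \<circ> ?s) x = Some c \<longleftrightarrow> (place_step d p q f \<circ> ?s) x = Some c"
    unfolding o_apply place_step_eq_Some_iff[OF f] S_def T_def .
qed

lemma run_transpose:
  assumes "finite_matching f" "m \<in> dom f \<or> Suc m \<in> dom f" "\<forall>(d, p, q) \<in> set B. p \<le> m"
  shows "run B (f \<circ> transpose m (Suc m)) = run B f \<circ> transpose m (Suc m)"
  using assms
proof (induction B arbitrary: f)
  case (Cons b B)
  obtain d p q where b: "b = (d, p, q)" by (cases b)
  let ?g = "place_step d p q f"
  have g: "finite_matching ?g" by (rule finite_matching_place_step[OF Cons.prems(1)])
  have occ: "m \<in> dom ?g \<or> Suc m \<in> dom ?g"
    using Cons.prems(2) unfolding dom_place_step[OF Cons.prems(1)] by blast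
  have "p \<le> m" "\<forall>(d, p, q) \<in> set B. p \<le> m" using Cons.prems(3) b by auto
  then show ?case
    unfolding b run_Cons place_step_transpose[OF Cons.prems(1) \<open>p \<le> m\<close> Cons.prems(2)]
    by (intro Cons.IH[OF g occ])
qed simp

lemma fill_transpose:
  assumes m: "0 < m" and occ: "m \<in> dom f \<or> Suc m \<in> dom f"
  shows "fill (f \<circ> transpose m (Suc m)) x = fill f (transpose m (Suc m) x)"
proof (cases "f (transpose m (Suc m) x)")
  case None
  let ?s = "transpose m (Suc m)"
  let ?A = "{y. 0 < y \<and> y < x \<and> y \<notin> dom (f \<circ> ?s)}" and ?B = "{y. 0 < y \<and> y < ?s x \<and> y \<notin> dom f}"
  have "?s y < x \<longleftrightarrow> y < ?s x" if "y \<notin> dom f" for y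
  proof (cases "y = ?s x")
    case False
    define z where "z = ?s x"
    have x: "x = ?s z" by (simp add: z_def)
    have "\<not> (y \<in> {m, Suc m} \<and> z \<in> {m, Suc m})" using occ None that False unfolding z_def[symmetric]
      by auto
    then show ?thesis using transpose_Suc_less_iff[of y z m] False by (simp add: x)
  qed simp
  moreover have "0 < ?s y \<longleftrightarrow> 0 < y" for y using m by (auto simp: transpose_def)
  ultimately have "?s y \<in> ?A \<longleftrightarrow> y \<in> ?B" for y by (auto simp: domIff)
  then have "?A = ?s ` ?B"
    by (metis (no_types, lifting) image_eqI imageE set_eqI transpose_involutory)
  then have "card ?A = card ?B"
    by (simp only: card_image[OF inj_on_subset[OF inj_transpose subset_UNIV]])
  then show ?thesis using None unfolding fill_def ran_transpose by simp
qed (simp add: fill_def)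

lemma w_of_transpose:
  assumes m: "0 < m" and occ: "m \<in> dom (placement \<tau>) \<or> Suc m \<in> dom (placement \<tau>)"
    and pl: "placement \<tau>' = placement \<tau> \<circ> transpose m (Suc m)"
  shows "w_of \<tau>' = w_of \<tau> \<circ> simple_refl m"
proof
  have pos: "w_of \<tau>' (int x) = w_of \<tau> (simple_refl m (int x))" if x: "0 < x" for x
  proof -
    have "simple_refl m (int x) = int (transpose m (Suc m) x)"
      using m by (auto simp: simple_refl_pos transpose_def)
    moreover have "0 < transpose m (Suc m) x" using m x by (auto simp: transpose_def)
    ultimately show ?thesis
      using w_of_pos[OF x, of \<tau>'] w_of_pos[of "transpose m (Suc m) x" \<tau>] fill_transpose[OF m occ] pl
      by simp
  qed
  fix i :: int
  show "w_of \<tau>' i = (w_of \<tau> \<circ> simple_refl m) i"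
    using pos[of "nat i"] pos[of "nat (- i)"] w_of_minus[of \<tau>' i] w_of_minus[of \<tau> "simple_refl m i"]
      simple_refl_minus[of m i] m
    by (cases i "0::int" rule: linorder_cases) (auto simp: w_of_def simple_refl_pos)
qed

lemma w_of_drop_1:
  assumes none: "g 1 = None" and e: "e = enumerate (unused 1 g) 0"
    and pl: "placement \<tau>' = g" "placement \<tau> = g(1 \<mapsto> e)"
  shows "w_of \<tau>' = w_of \<tau> \<circ> simple_refl 0"
proof
  let ?U = "{c. 0 < c \<and> c \<notin> ran g}"
  have U: "unused 1 g = ?U" by (auto simp: Suc_le_eq)
  have emp: "{y. 0 < y \<and> y < (1::nat) \<and> y \<notin> dom g} = {}" by auto
  have "fill g 1 = int e" using none unfolding fill_def emp e U by simp
  then have one: "w_of \<tau>' 1 = - w_of \<tau> 1"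
    using w_of_pos[of 1 \<tau>'] w_of_pos[of 1 \<tau>] pl by (simp add: fill_Some)
  have big: "fill g x = fill (g(1 \<mapsto> e)) x" if x: "1 < x" for x
  proof (cases "g x")
    case None
    have "{c. 0 < c \<and> c \<notin> ran (g(1 \<mapsto> e))} = ?U - {enumerate ?U 0}"
      using none e U by auto
    moreover have "{y. 0 < y \<and> y < x \<and> y \<notin> dom g} =
        insert 1 {y. 0 < y \<and> y < x \<and> y \<notin> dom (g(1 \<mapsto> e))}"
      using none x by auto
    then have "card {y. 0 < y \<and> y < x \<and> y \<notin> dom g} =
        Suc (card {y. 0 < y \<and> y < x \<and> y \<notin> dom (g(1 \<mapsto> e))})"
      by simp
    ultimately show ?thesis using None x unfolding fill_def by (simp only: enumerate_Suc') simp
  qed (use x in \<open>simp add: fill_def\<close>)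
  have pos: "w_of \<tau>' (int x) = w_of \<tau> (simple_refl 0 (int x))" if x: "0 < x" for x
  proof (cases "x = 1")
    case True
    then show ?thesis using one w_of_minus[of \<tau> 1] by (simp add: simple_refl_0)
  next
    case False
    then show ?thesis
      using w_of_pos[OF x, of \<tau>'] w_of_pos[OF x, of \<tau>] big[of x] x pl by (simp add: simple_refl_0)
  qed
  fix i :: int
  show "w_of \<tau>' i = (w_of \<tau> \<circ> simple_refl 0) i"
    using pos[of "nat i"] pos[of "nat (- i)"] w_of_minus[of \<tau>' i] w_of_minus[of \<tau> "simple_refl 0 i"]
      simple_refl_minus[of 0 i]
    by (cases i "0::int" rule: linorder_cases) (auto simp: w_of_def simple_refl_0)
qed


section \<open>Removable labels\<close>

text \<open>The corner row of step \<open>i\<close> has \<open>p + q - 1\<close> boxes. Label 0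
  means \<open>p = 1\<close>, so a single box means \<open>q = 1\<close>.\<close>

lemma removable_ldiagram_of_iff:
  assumes es: "essential \<tau>"
  shows "removable (ldiagram_of \<tau>) m \<longleftrightarrow> (\<exists>i<tsize \<tau>. pp \<tau> ! i = Suc m \<and>
    (\<forall>j<tsize \<tau>. pp \<tau> ! j = Suc m \<longrightarrow> j = i) \<and> (m = 0 \<longrightarrow> qq \<tau> ! i = 1))"
proof -
  have tr: "is_triple \<tau>" using es by (simp add: essential_def)
  have len: "length (pp \<tau>) = tsize \<tau>" using tr by (simp add: is_triple_def)
  have lab: "pp \<tau> ! i - 1 = m \<longleftrightarrow> pp \<tau> ! i = Suc m" if "i < tsize \<tau>" for i
    using tr that by (force simp: is_triple_def)
  have rl: "row_length (lambda_of \<tau>) (kk \<tau> ! i) = pp \<tau> ! i + qq \<tau> ! i - 1" if i: "i < tsize \<tau>" for i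
  proof -
    have k: "kprev \<tau> i < kk \<tau> ! i" by (rule kprev_less[OF tr i])
    then show ?thesis
      using nth_lambda_of[OF tr i k order_refl] row_length_eq[of "kk \<tau> ! i" "lambda_of \<tau>"] by simp
  qed
  define I where "I = {i. i < tsize \<tau> \<and> pp \<tau> ! i = Suc m}"
  have "count_list (labels (ldiagram_of \<tau>)) m = card {i. i < tsize \<tau> \<and> m = pp \<tau> ! i - 1}"
    unfolding count_list_eq_length_filter length_filter_conv_card
    by (simp add: ldiagram_of_def len cong: conj_cong)
  also have "{i. i < tsize \<tau> \<and> m = pp \<tau> ! i - 1} = I" using lab by (auto simp: I_def)
  finally have "removable (ldiagram_of \<tau>) m \<longleftrightarrow> card I = 1 \<and> (m = 0 \<longrightarrow> (\<forall>i\<in>I. qq \<tau> ! i = 1))"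
    unfolding removable_def using lab
    by (auto simp: ldiagram_of_def len corner_rows_lambda_of[OF es] rl I_def)
  also have "\<dots> \<longleftrightarrow> (\<exists>i. I = {i} \<and> (m = 0 \<longrightarrow> qq \<tau> ! i = 1))"
    by (auto simp: card_1_singleton_iff)
  also have "\<dots> \<longleftrightarrow> (\<exists>i<tsize \<tau>. pp \<tau> ! i = Suc m \<and>
    (\<forall>j<tsize \<tau>. pp \<tau> ! j = Suc m \<longrightarrow> j = i) \<and> (m = 0 \<longrightarrow> qq \<tau> ! i = 1))"
    unfolding I_def set_eq_iff by auto
  finally show ?thesis .
qed

text \<open>An entry placed in position \<open>m\<close> comes from a step after \<open>i\<close>.
  The essential bound, which still applies one position left of \<open>pp \<tau> ! i\<close>, makes
  its value smaller than \<open>c\<close>.\<close>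

lemma descent_at_position:
  assumes es: "essential \<tau>" and i: "i < tsize \<tau>" "pp \<tau> ! i = Suc m"
    and uniq: "\<And>j. j < tsize \<tau> \<Longrightarrow> pp \<tau> ! j = Suc m \<Longrightarrow> j = i"
  shows "Suc m \<in> dom (placement \<tau>)" "descent (w_of \<tau>) m"
proof -
  have tr: "is_triple \<tau>" using es by (simp add: essential_def)
  have "pp \<tau> ! j \<noteq> pp \<tau> ! i" if "j < i" for j using uniq[of j] that i by auto
  then obtain c where c: "placed \<tau> i (Suc m) c" "qq \<tau> ! i \<le> c"
    using placed_at_first_position[OF tr i(1)] i(2) by metis
  have fc: "placement \<tau> (Suc m) = Some c" using c(1) i(1) placement_eq_Some_iff by blast
  then show "Suc m \<in> dom (placement \<tau>)" by auto
  have c0: "0 < c" by (rule placement_pos(2)[OF tr fc])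
  have w: "w_of \<tau> (int m + 1) = - int c"
    using w_of_pos[of "Suc m" \<tau>] fc by (simp add: fill_Some add.commute)
  have "w_of \<tau> (int m + 1) < w_of \<tau> (int m)" if m: "0 < m"
  proof (cases "placement \<tau> m")
    case None
    then show ?thesis
      using w w_of_pos[OF m, of \<tau>] fill_None(1)[OF finite_matching_placement None] by simp
  next
    case (Some b)
    then obtain l where l: "l < tsize \<tau>" "placed \<tau> l m b" using placement_eq_Some_iff by blast
    have "i < l" using placed_ge(1)[OF l(2)] triple_antimono[OF tr _ i(1), of l] i(2)
      by (cases "i < l") auto
    then have "b < c" using placed_outside_earlier_essential[OF es _ l, of i] i(2) c(2) by simp
    then show ?thesis using w w_of_pos[OF m, of \<tau>] Some by (simp add: fill_Some)
  qed
  then show "descent (w_of \<tau>) m" using w c0 by (auto simp: descent_def)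
qed

text \<open>For \<open>m > 0\<close> the step \<open>(d, p, q)\<close> with \<open>p = m + 1\<close> is replaced by the two steps
  \<open>(d - 1, p + 1, q)\<close> and \<open>(1, p - 1, q)\<close>; for \<open>m = 0\<close> the second of these is dropped. The first
  one is dropped if \<open>d = 1\<close>.\<close>

lemma vexillary_removal:
  assumes es: "essential \<tau>" and i: "i < tsize \<tau>" "pp \<tau> ! i = Suc m"
    and uniq: "\<And>j. j < tsize \<tau> \<Longrightarrow> pp \<tau> ! j = Suc m \<Longrightarrow> j = i"
    and q1: "m = 0 \<Longrightarrow> qq \<tau> ! i = 1"
  shows "\<exists>\<tau>'. is_triple \<tau>' \<and> w_of \<tau>' = w_of \<tau> \<circ> simple_refl m"
proof -
  have tr: "is_triple \<tau>" using es by (simp add: essential_def)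
  define A B d q f where "A = take i (steps \<tau>)" and "B = drop (Suc i) (steps \<tau>)"
    and "d = kk \<tau> ! i - kprev \<tau> i" and "q = qq \<tau> ! i" and "f = stage \<tau> i"
  have len: "length (steps \<tau>) = tsize \<tau>" by (simp add: steps_def)
  have nth: "steps \<tau> ! j = (kk \<tau> ! j - kprev \<tau> j, pp \<tau> ! j, qq \<tau> ! j)" if "j < tsize \<tau>" for j
    using that by (simp add: steps_def)
  have L: "steps \<tau> = A @ (d, Suc m, q) # B"
    using id_take_nth_drop[of i "steps \<tau>"] i len nth[OF i(1)] by (simp add: A_def B_def d_def q_def)
  obtain n where n: "d = Suc n" using kprev_less[OF tr i(1)] unfolding d_def by (metis Suc_diff_Suc)
  have runA: "run A Map.empty = f" using run_take_steps[of i \<tau>] i(1) by (simp add: A_def f_def)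
  have f: "finite_matching f" by (simp add: f_def finite_matching_stage)
  have pl: "placement \<tau> = run B (place_step d (Suc m) q f)"
    unfolding placement_eq_run L run_append runA run_Cons ..
  have pA: "Suc (Suc m) \<le> pp \<tau> ! j" if "j < i" for j
    using triple_antimono[OF tr, of j i] uniq[of j] that i by (cases "pp \<tau> ! j = Suc m") auto
  have vac: "x \<notin> dom f" if "x \<le> Suc m" for x
  proof
    assume "x \<in> dom f"
    then obtain j c where "j < i" "placed \<tau> j x c" by (auto simp: f_def mem_dom_stage_iff)
    then show False using placed_ge(1)[of \<tau> j x c] pA[of j] that by simp
  qed
  have setA: "Suc (Suc m) \<le> p'" if t: "(d', p', q') \<in> set A" for d' p' q'
  proof -
    obtain j where "j < length A" "A ! j = (d', p', q')" using t by (auto simp: in_set_conv_nth)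
    then show ?thesis using pA[of j] nth[of j] i(1) len by (simp add: A_def)
  qed
  have setB: "p' \<le> m" if t: "(d', p', q') \<in> set B" for d' p' q'
  proof -
    obtain j where j: "j < length B" "B ! j = (d', p', q')" using t by (auto simp: in_set_conv_nth)
    then have l: "Suc i + j < tsize \<tau>" "pp \<tau> ! (Suc i + j) = p'"
      using nth[of "Suc i + j"] len by (auto simp: B_def)
    then have "p' \<noteq> Suc m" "p' \<le> Suc m"
      using uniq[of "Suc i + j"] triple_antimono[OF tr, of i "Suc i + j"] i by auto
    then show ?thesis by simp
  qed
  \<comment> \<open>Lowering \<open>p\<close> from \<open>m + 1\<close> to \<open>m\<close> costs
    one unit in the gap condition; the strict inequality of an essential triple pays for it.\<close>
  have hdB: "d' + p' + q' \<le> m + q" if "B \<noteq> []" "hd B = (d', p', q')" for d' p' q'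
  proof -
    have Si: "Suc i < tsize \<tau>" using that(1) len by (simp add: B_def)
    then have "(d', p', q') = (kk \<tau> ! Suc i - kk \<tau> ! i, pp \<tau> ! Suc i, qq \<tau> ! Suc i)"
      using that(2) nth[OF Si] len by (simp add: B_def hd_drop_conv_nth kprev_def)
    then show ?thesis
      using essential_decreasing[OF es, of i "Suc i"] Si i(2) triple_antimono[OF tr, of i "Suc i"]
      by (auto simp: q_def)
  qed
  let ?P = "\<lambda>(d, p, q) (d', p', q'). p' \<le> p \<and> q' \<le> q \<and> d' + p' + q' \<le> p + q"
  have adm: "admissible (A @ (d, Suc m, q) # B)" using admissible_steps[OF tr] L by simp
  have posA: "\<forall>(d, p, q) \<in> set A. 0 < d \<and> 0 < p \<and> 0 < q"
    and posB: "\<forall>(d, p, q) \<in> set B. 0 < d \<and> 0 < p \<and> 0 < q"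
    and q0: "0 < q" and sA: "successively ?P A" and sB: "successively ?P B"
    and lA: "A \<noteq> [] \<Longrightarrow> ?P (last A) (d, Suc m, q)"
    and lB: "B \<noteq> [] \<Longrightarrow> ?P (d, Suc m, q) (hd B)"
    using adm by (auto simp: admissible_def successively_append_iff successively_Cons)
  \<comment> \<open>Raising \<open>p\<close> by one is offset by lowering \<open>d\<close> by one,
    and by uniqueness the steps in \<open>A\<close> have \<open>p\<close> at least
    \<open>m + 2\<close>.\<close>
  have lA': "?P (last A) (n, Suc (Suc m), q)" if "A \<noteq> []"
    using lA[OF that] setA last_in_set[OF that] n by (cases "last A") auto
  have occ: "Suc m \<in> dom (placement \<tau>)" by (rule descent_at_position(1)[OF es i uniq])
  let ?A' = "A @ (if n = 0 then [] else [(n, Suc (Suc m), q)])"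
  have runA': "run ?A' Map.empty = place_step n (Suc (Suc m)) q f"
    by (simp add: run_append runA run_Cons)
  have admA': "admissible ?A'"
    using posA sA q0 lA' by (auto simp: admissible_def successively_append_iff)
  show ?thesis
  proof (cases "m = 0")
    case True
    \<comment> \<open>Later steps would need a positive \<open>p\<close> that is at most
      \<open>m = 0\<close>.\<close>
    have "B = []"
    proof (rule ccontr)
      assume "B \<noteq> []"
      then obtain d' p' q' where "(d', p', q') \<in> set B" by (cases B) auto
      then show False using setB[of d' p' q'] posB True by auto
    qed
    have q: "q = 1" using q1[OF True] by (simp add: q_def)
    let ?g = "place_step n 2 1 f"
    have pl': "placement (triple_of ?A') = ?g"
      unfolding placement_triple_of runA' using True q by (simp add: numeral_2_eq_2)
    have "1 \<notin> dom f" using vac[of 1] by simp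
    then have none: "?g 1 = None" using place_step_not_dom[OF f] by simp
    have "placement \<tau> = ?g(1 \<mapsto> enumerate (unused 1 f) n)"
      using pl \<open>B = []\<close> q n True place_step_first[OF f \<open>1 \<notin> dom f\<close>, of n 1]
        by (simp add: numeral_2_eq_2)
    then have "w_of (triple_of ?A') = w_of \<tau> \<circ> simple_refl 0"
      by (intro w_of_drop_1[of ?g "enumerate (unused 1 f) n"] none pl'
          enumerate_unused_place_step[OF f, symmetric])
    then show ?thesis using is_triple_triple_of[OF admA'] True by blast
  next
    case False
    let ?L = "?A' @ (1, m, q) # B"
    have "run ?L Map.empty = run B (place_step 1 m q (place_step n (Suc (Suc m)) q f))"
      by (simp only: run_append[of ?A'] runA' run_Cons)
    also have "\<dots> = run B (place_step d (Suc m) q f \<circ> transpose m (Suc m))"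
      using place_step_split[OF f, of m q n] vac[of m] vac[of "Suc m"] n by simp
    \<comment> \<open>Position \<open>m + 1\<close> is filled by the original step and all later
      steps have \<open>p \<le> m\<close>, so the exchange passes through \<open>B\<close>.\<close>
    also have "\<dots> = placement \<tau> \<circ> transpose m (Suc m)"
      unfolding pl
    proof (rule run_transpose)
      show "finite_matching (place_step d (Suc m) q f)" by (rule finite_matching_place_step[OF f])
      show "m \<in> dom (place_step d (Suc m) q f) \<or> Suc m \<in> dom (place_step d (Suc m) q f)"
        using place_step_first[OF f vac[of "Suc m"], of n q] n by simp
    qed (use setB in auto)
    finally have pl': "placement (triple_of ?L) = placement \<tau> \<circ> transpose m (Suc m)"
      by (simp only: placement_triple_of)
    have w: "w_of (triple_of ?L) = w_of \<tau> \<circ> simple_refl m"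
      by (rule w_of_transpose[OF _ _ pl']) (use False occ in auto)
    have l1: "?P (last ?A') (1, m, q)" if "?A' \<noteq> []"
    proof (cases "n = 0")
      case True
      then have "A \<noteq> []" using that by simp
      then show ?thesis using lA n True by (cases "last A") auto
    qed simp
    have l2: "?P (1, m, q) (hd B)" if "B \<noteq> []"
      using hdB[OF that] setB hd_in_set[OF that] lB[OF that] by (cases "hd B") auto
    have "admissible ?L"
      using admA' l1 l2 posB q0 sB False
      unfolding admissible_def successively_append_iff[of _ ?A'] successively_Cons set_append
      by (auto simp del: append_is_Nil_conv)
    then show ?thesis using is_triple_triple_of w by blast
  qed
qed

theorem theorem4p1:
  fixes \<tau> :: triple and w :: "int \<Rightarrow> int" and Y :: ldiagram and m :: nat
  assumes "essential \<tau>"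
    and "w = w_of \<tau>"
    and "Y = ldiagram_of \<tau>"
  shows "vexillary (w \<circ> simple_refl m) \<and>
         int (sp_length (w \<circ> simple_refl m)) = int (sp_length w) - 1
         \<longleftrightarrow> removable Y m"
proof -
  have tr: "is_triple \<tau>" using assms(1) by (simp add: essential_def)
  have sp: "signed_perm w" using signed_perm_w_of[OF tr] assms(2) by simp
  have len: "int (sp_length (w \<circ> simple_refl m)) = int (sp_length w) - 1 \<longleftrightarrow> descent w m"
    by (rule sp_length_simple_refl_iff[OF sp])
  have vex: "vexillary (w \<circ> simple_refl m) \<longleftrightarrow> (\<exists>\<tau>'. is_triple \<tau>' \<and> w \<circ> simple_refl m = w_of \<tau>')"
    using signed_perm_simple_refl[OF sp] by (auto simp: vexillary_def)
  show ?thesis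
    unfolding len vex assms(3) removable_ldiagram_of_iff[OF assms(1)]
  proof
    assume "(\<exists>\<tau>'. is_triple \<tau>' \<and> w \<circ> simple_refl m = w_of \<tau>') \<and> descent w m"
    then show "\<exists>i<tsize \<tau>. pp \<tau> ! i = Suc m \<and> (\<forall>j<tsize \<tau>. pp \<tau> ! j = Suc m \<longrightarrow> j = i) \<and>
        (m = 0 \<longrightarrow> qq \<tau> ! i = 1)"
      using vexillary_descent_unique[OF assms(1)] assms(2) by blast
  next
    assume "\<exists>i<tsize \<tau>. pp \<tau> ! i = Suc m \<and> (\<forall>j<tsize \<tau>. pp \<tau> ! j = Suc m \<longrightarrow> j = i) \<and>
        (m = 0 \<longrightarrow> qq \<tau> ! i = 1)"
    then obtain i where i: "i < tsize \<tau>" "pp \<tau> ! i = Suc m" "m = 0 \<Longrightarrow> qq \<tau> ! i = 1"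
      and uniq: "\<And>j. j < tsize \<tau> \<Longrightarrow> pp \<tau> ! j = Suc m \<Longrightarrow> j = i" by blast
    have "descent w m" using descent_at_position(2)[OF assms(1) i(1,2) uniq] assms(2) by blast
    moreover obtain \<tau>' where "is_triple \<tau>'" "w_of \<tau>' = w_of \<tau> \<circ> simple_refl m"
      using vexillary_removal[OF assms(1) i(1,2) uniq i(3)] by blast
    ultimately show "(\<exists>\<tau>'. is_triple \<tau>' \<and> w \<circ> simple_refl m = w_of \<tau>') \<and> descent w m"
      using assms(2) by metis
  qed
qed

end
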